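(* Let $m>1$ be an integer, let $\mathbb F$ be an algebraically closed field of characteristic $p>0$, and let $\lambda=(\lambda_1,\dots,\lambda_{2m+1})\in\mathbb F^{2m+1}$. Let $\mathfrak h_m^\lambda$ be the Heisenberg Lie algebra of dimension $2m+1$ over $\mathbb F$ with the restricted structure determined by $e_i^{[p]}=\lambda_i e_{2m+1}$. Then $$\dim H^1_*(\mathfrak h_m^\lambda,\mathfrak h_m^\lambda)=\begin{cases}2m^2+m+1,& p>2,\ \lambda=0;\\ 2m^2+m,& p>2,\ \lambda\neq0;\\ 2m^2-m+1,& p=2,\ \lambda_{2m+1}=0;\\ 2m^2-m,& p=2,\ \lambda_{2m+1}\neq0,\end{cases}$$ and $$\dim H^2_*(\mathfrak h_m^\lambda,\mathfrak h_m^\lambda)=\begin{cases}\frac83m^3+\frac43m+1,& p>2,\ \lambda=0;\\ \frac83m^3+\frac43m,& p>2,\ \lambda\neq0;\\ \frac83m^3-\frac23m+1,& p=2,\ \lambda_{2m+1}=0;\\ \frac83m^3-\frac23m,& p=2,\ \lambda_{2m+1}\neq0.\end{cases}$$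
   Context: **Heisenberg algebra.** $\mathfrak h_m$ is the Lie algebra over $\mathbb F$ with basis $e_1,\dots,e_{2m+1}$ whose only non-vanishing brackets of basis vectors are $[e_i,e_{m+i}]=e_{2m+1}$ for $1\le i\le m$ (and those forced by antisymmetry). For $\lambda\in\mathbb F^{2m+1}$, $\mathfrak h_m^\lambda$ is $\mathfrak h_m$ with the $[p]$-map determined by $e_i^{[p]}=\lambda_ie_{2m+1}$; explicitly, for $g=\sum a_ie_i$, $g^{[p]}=\big(\sum_{i=1}^{2m+1}a_i^p\lambda_i\big)e_{2m+1}$ if $p>2$, and $g^{[2]}=\big(\sum_{i=1}^{2m+1}a_i^2\lambda_i+\sum_{j=1}^m a_ja_{m+j}\big)e_{2m+1}$ if $p=2$. **Ordinary cochains.** $C^0=\mathfrak h_m$ and $C^q=\mathrm{Hom}(\wedge^q\mathfrak h_m,\mathfrak h_m)$, with the Chevalley–Eilenberg differentials with adjoint coefficients: $d^0(x)(g)=[x,g]$; $d^1(\psi)(g\wedge h)=[g,\psi(h)]-[h,\psi(g)]-\psi([g,h])$; $d^2(\phi)(g\wedge h\wedge k)=[g,\phi(h\wedge k)]-[h,\phi(g\wedge k)]+[k,\phi(g\wedge h)]-\phi([g,h]\wedge k)+\phi([g,k]\wedge h)-\phi([h,k]\wedge g)$. **Restricted cochains.** Iterated brackets are left-normed: $[g_1,\dots,g_j]=[[\dots[[g_1,g_2],g_3],\dots],g_j]$, with $[g_1]=g_1$. For $\phi\in C^2$, a map $\omega:\mathfrak h_m\to\mathfrak h_m$ is $\phi$-compatible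 if $\omega(ag)=a^p\omega(g)$ and $$\omega(g+h)=\omega(g)+\omega(h)+\sum_{\substack{g_i=g\text{ or }h\\ g_1=g,\,g_2=h}}\frac1{\#(g)}\Big(\phi([g_1,\dots,g_{p-1}]\wedge g_p)-[g_p,\phi([g_1,\dots,g_{p-2}]\wedge g_{p-1})]\Big)$$ for all $a\in\mathbb F$, $g,h\in\mathfrak h_m$, where the sum is over sequences $(g_1,\dots,g_p)$ of symbols and $\#(g)$ is the number of $g_i$ equal to $g$. For $p=2$ the second term is absent, i.e. $\omega(g+h)=\omega(g)+\omega(h)+\phi(g\wedge h)$. Put $C^1_*=C^1$ and $C^2_*=\{(\phi,\omega):\phi\in C^2,\ \omega\ \phi\text{-compatible}\}$. **Restricted cohomology.** Put $d^0_*=d^0$. For $\psi\in C^1$, let $\mathrm{ind}^1(\psi)(g)=\psi(g^{[p]})-(\mathrm{ad}\,g)^{p-1}(\psi(g))$ and $d^1_*(\psi)=(d^1\psi,\mathrm{ind}^1(\psi))\in C^2_*$. For $(\phi,\omega)\in C^2_*$, let $$\mathrm{ind}^2(\phi,\omega)(g,h)=\phi(g\wedge h^{[p]})+[g,\omega(h)]+\phi(h\wedge(\mathrm{ad}\,h)^{p-1}(g))+[h,\phi(h\wedge(\mathrm{ad}\,h)^{p-2}(g))]$$ and $d^2_*(\phi,\omega)=(d^2\phi,\mathrm{ind}^2(\phi,\omega))$. Then $H^q_*(\mathfrak h_m^\lambda,\mathfrak h_m^\lambda)=\ker d^q_*/\mathrm{im}\,d^{q-1}_*$ for $q=1,2$.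 Dimensions are over $\mathbb F$.
   Formalization: The coboundary is taken as d^1_*(ψ) = (d^1ψ, −ind^1(ψ)); with the printed sign, im d^1_* is not contained in ker d^2_* when p>2 and λ≠0, so H^2_* would be undefined there. *)

theory Defs
  imports
    "HOL-Analysis.Cartesian_Space"
    "HOL-Library.Function_Algebras"
    "HOL-Library.Product_Plus"
    "HOL-Algebra.Algebraic_Closure_Type"
    "Jordan_Normal_Form.Missing_VectorSpace"
begin

unbundle no fps_syntax

section \<open>The Heisenberg algebra\<close>

text \<open>
  With \<open>m = CARD('m)\<close>, the index type \<open>('m + 'm) option\<close> plays the role of \<open>{1,\<dots>,2m+1}\<close>:
  \<open>Some (Inl i)\<close> is the index \<open>i\<close>, \<open>Some (Inr i)\<close> is \<open>m+i\<close>, and \<open>None\<close> is \<open>2m+1\<close>.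
  The basis vector \<open>e\<^sub>k\<close> is \<open>axis k 1\<close>.
\<close>

type_synonym ('a, 'm) heis = "'a ^ (('m + 'm) option)"

definition heis_bracket :: "('a::field, 'm::finite) heis \<Rightarrow> ('a, 'm) heis \<Rightarrow> ('a, 'm) heis" where
  "heis_bracket x y =
     (\<Sum>i\<in>UNIV. x $ Some (Inl i) * y $ Some (Inr i) - x $ Some (Inr i) * y $ Some (Inl i))
       *s axis None 1"

definition heis_pmap :: "('a::field, 'm::finite) heis \<Rightarrow> ('a, 'm) heis \<Rightarrow> ('a, 'm) heis" where
  "heis_pmap lam g =
     ((\<Sum>k\<in>UNIV. (g $ k) ^ CHAR('a) * lam $ k) +
      (if CHAR('a) = 2 then \<Sum>j\<in>UNIV. g $ Some (Inl j) * g $ Some (Inr j) else 0))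
       *s axis None 1"

fun left_normed :: "('a::field, 'm::finite) heis list \<Rightarrow> ('a, 'm) heis" where
  "left_normed [] = 0"
| "left_normed (x # xs) = foldl heis_bracket x xs"


section \<open>Ordinary cochains with adjoint coefficients\<close>

definition C1 :: "(('a::field, 'm::finite) heis \<Rightarrow> ('a, 'm) heis) set" where
  "C1 = {\<psi>. Vector_Spaces.linear (*s) (*s) \<psi>}"

text \<open>\<open>Hom(\<And>\<^sup>2 h, h)\<close> is represented by the alternating bilinear maps.\<close>

definition C2 :: "(('a::field, 'm::finite) heis \<Rightarrow> ('a, 'm) heis \<Rightarrow> ('a, 'm) heis) set" where
  "C2 = {\<phi>. (\<forall>g. Vector_Spaces.linear (*s) (*s) (\<phi> g)) \<and>
             (\<forall>h. Vector_Spaces.linear (*s) (*s) (\<lambda>g. \<phi> g h)) \<and>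
             (\<forall>g. \<phi> g g = 0)}"

definition d0 :: "('a::field, 'm::finite) heis \<Rightarrow> ('a, 'm) heis \<Rightarrow> ('a, 'm) heis" where
  "d0 x g = heis_bracket x g"

definition d1 ::
  "(('a::field, 'm::finite) heis \<Rightarrow> ('a, 'm) heis) \<Rightarrow>
     ('a, 'm) heis \<Rightarrow> ('a, 'm) heis \<Rightarrow> ('a, 'm) heis" where
  "d1 \<psi> g h = heis_bracket g (\<psi> h) - heis_bracket h (\<psi> g) - \<psi> (heis_bracket g h)"

definition d2 ::
  "(('a::field, 'm::finite) heis \<Rightarrow> ('a, 'm) heis \<Rightarrow> ('a, 'm) heis) \<Rightarrow>
     ('a, 'm) heis \<Rightarrow> ('a, 'm) heis \<Rightarrow> ('a, 'm) heis \<Rightarrow> ('a, 'm) heis" where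
  "d2 \<phi> g h k =
     heis_bracket g (\<phi> h k) - heis_bracket h (\<phi> g k) + heis_bracket k (\<phi> g h)
     - \<phi> (heis_bracket g h) k + \<phi> (heis_bracket g k) h - \<phi> (heis_bracket h k) g"


section \<open>Restricted cochains\<close>

text \<open>
  A sequence of symbols \<open>(g\<^sub>1,\<dots>,g\<^sub>p)\<close> is a Boolean list, with \<open>True\<close> standing for \<open>g\<close> and \<open>False\<close>
  for \<open>h\<close>; thus \<open>#(g)\<close> counts symbols even when \<open>g\<close> and \<open>h\<close> are the same element.
  List positions start at \<open>0\<close>.
\<close>

definition compat_term ::
  "(('a::field, 'm::finite) heis \<Rightarrow> ('a, 'm) heis \<Rightarrow> ('a, 'm) heis) \<Rightarrow>
     ('a, 'm) heis list \<Rightarrow> ('a, 'm) heis" where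
  "compat_term \<phi> xs =
     (let p = CHAR('a) in
        \<phi> (left_normed (take (p - 1) xs)) (xs ! (p - 1)) -
        (if p = 2 then 0
         else heis_bracket (xs ! (p - 1)) (\<phi> (left_normed (take (p - 2) xs)) (xs ! (p - 2)))))"

definition compatible ::
  "(('a::field, 'm::finite) heis \<Rightarrow> ('a, 'm) heis \<Rightarrow> ('a, 'm) heis) \<Rightarrow>
     (('a, 'm) heis \<Rightarrow> ('a, 'm) heis) \<Rightarrow> bool" where
  "compatible \<phi> \<omega> \<longleftrightarrow>
     (\<forall>a g. \<omega> (a *s g) = a ^ CHAR('a) *s \<omega> g) \<and>
     (\<forall>g h. \<omega> (g + h) = \<omega> g + \<omega> h +
        (\<Sum>s\<in>{s. length s = CHAR('a) \<and> s ! 0 = True \<and> s ! 1 = False}.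
           inverse (of_nat (count_list s True)) *s
             compat_term \<phi> (map (\<lambda>b. if b then g else h) s)))"

definition C2_res ::
  "((('a::field, 'm::finite) heis \<Rightarrow> ('a, 'm) heis \<Rightarrow> ('a, 'm) heis) \<times>
     (('a, 'm) heis \<Rightarrow> ('a, 'm) heis)) set" where
  "C2_res = {(\<phi>, \<omega>). \<phi> \<in> C2 \<and> compatible \<phi> \<omega>}"

definition ind1 ::
  "('a::field, 'm::finite) heis \<Rightarrow> (('a, 'm) heis \<Rightarrow> ('a, 'm) heis) \<Rightarrow>
     ('a, 'm) heis \<Rightarrow> ('a, 'm) heis" where
  "ind1 lam \<psi> g = \<psi> (heis_pmap lam g) - (heis_bracket g ^^ (CHAR('a) - 1)) (\<psi> g)"

definition ind2 ::
  "('a::field, 'm::finite) heis \<Rightarrow> (('a, 'm) heis \<Rightarrow> ('a, 'm) heis \<Rightarrow> ('a, 'm) heis) \<Rightarrow>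
     (('a, 'm) heis \<Rightarrow> ('a, 'm) heis) \<Rightarrow> ('a, 'm) heis \<Rightarrow> ('a, 'm) heis \<Rightarrow> ('a, 'm) heis" where
  "ind2 lam \<phi> \<omega> g h =
     \<phi> g (heis_pmap lam h) + heis_bracket g (\<omega> h)
     + \<phi> h ((heis_bracket h ^^ (CHAR('a) - 1)) g)
     + heis_bracket h (\<phi> h ((heis_bracket h ^^ (CHAR('a) - 2)) g))"

text \<open>
  The sign of the second component of \<open>d1_res\<close>: with the signs of \<open>d1\<close>, \<open>compatible\<close> and \<open>ind2\<close>
  used here (those of a first-order deformation of bracket and \<open>p\<close>-map), the coboundary of \<open>\<psi>\<close> is
  \<open>(d1 \<psi>, - ind1 \<psi>)\<close>, equivalently, after replacing \<open>\<psi>\<close> by \<open>- \<psi>\<close>, \<open>(- d1 \<psi>, ind1 \<psi>)\<close>.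
  With \<open>(d1 \<psi>, ind1 \<psi>)\<close> one gets \<open>ind2 (d1 \<psi>) (ind1 \<psi>) g h = 2[g, \<psi>(h\<^sup>[\<^sup>p\<^sup>])]\<close> for \<open>p > 2\<close>,
  which need not vanish. For \<open>p = 2\<close>, and for \<open>p > 2\<close> and \<open>lam = 0\<close>, the sign is immaterial, and
  it never affects the kernel.
\<close>

definition d1_res ::
  "('a::field, 'm::finite) heis \<Rightarrow> (('a, 'm) heis \<Rightarrow> ('a, 'm) heis) \<Rightarrow>
     (('a, 'm) heis \<Rightarrow> ('a, 'm) heis \<Rightarrow> ('a, 'm) heis) \<times> (('a, 'm) heis \<Rightarrow> ('a, 'm) heis)" where
  "d1_res lam \<psi> = (d1 \<psi>, - ind1 lam \<psi>)"

definition d2_res ::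
  "('a::field, 'm::finite) heis \<Rightarrow>
     (('a, 'm) heis \<Rightarrow> ('a, 'm) heis \<Rightarrow> ('a, 'm) heis) \<times> (('a, 'm) heis \<Rightarrow> ('a, 'm) heis) \<Rightarrow>
     (('a, 'm) heis \<Rightarrow> ('a, 'm) heis \<Rightarrow> ('a, 'm) heis \<Rightarrow> ('a, 'm) heis) \<times>
     (('a, 'm) heis \<Rightarrow> ('a, 'm) heis \<Rightarrow> ('a, 'm) heis)" where
  "d2_res lam = (\<lambda>(\<phi>, \<omega>). (d2 \<phi>, ind2 lam \<phi> \<omega>))"


section \<open>Restricted cohomology\<close>

text \<open>
  The quotient \<open>Z / B\<close> of subspaces \<open>B \<subseteq> Z\<close> of a type with scalar multiplication \<open>sc\<close>, as a module
  record whose elements are the cosets of \<open>B\<close>. Adding \<open>B\<close> in \<open>smult\<close> matters for the scalar \<open>0\<close>.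
  The fields \<open>mult\<close> and \<open>one\<close> of the record have no meaning for a module.
\<close>

definition quotient_space ::
  "('a \<Rightarrow> 'v \<Rightarrow> 'v) \<Rightarrow> 'v::ab_group_add set \<Rightarrow> 'v set \<Rightarrow> ('a, 'v set) module" where
  "quotient_space sc Z B =
     \<lparr> carrier = {{z + b | b. b \<in> B} | z. z \<in> Z},
       monoid.mult = undefined, one = undefined,
       ring.zero = B,
       add = (\<lambda>S T. {x + y | x y. x \<in> S \<and> y \<in> T}),
       module.smult = (\<lambda>a S. {sc a x + b | x b. x \<in> S \<and> b \<in> B}) \<rparr>"

definition scale1 ::
  "'a::field \<Rightarrow> (('a, 'm::finite) heis \<Rightarrow> ('a, 'm) heis) \<Rightarrow> ('a, 'm) heis \<Rightarrow> ('a, 'm) heis" where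
  "scale1 a \<psi> = (\<lambda>g. a *s \<psi> g)"

definition scale2_res ::
  "'a::field \<Rightarrow>
     (('a, 'm::finite) heis \<Rightarrow> ('a, 'm) heis \<Rightarrow> ('a, 'm) heis) \<times> (('a, 'm) heis \<Rightarrow> ('a, 'm) heis) \<Rightarrow>
     (('a, 'm) heis \<Rightarrow> ('a, 'm) heis \<Rightarrow> ('a, 'm) heis) \<times> (('a, 'm) heis \<Rightarrow> ('a, 'm) heis)" where
  "scale2_res a = (\<lambda>(\<phi>, \<omega>). (\<lambda>g h. a *s \<phi> g h, \<lambda>g. a *s \<omega> g))"

definition H1_res ::
  "('a::field, 'm::finite) heis \<Rightarrow> ('a, (('a, 'm) heis \<Rightarrow> ('a, 'm) heis) set) module" where
  "H1_res lam = quotient_space scale1 {\<psi> \<in> C1. d1_res lam \<psi> = 0} (range d0)"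

definition H2_res ::
  "('a::field, 'm::finite) heis \<Rightarrow>
     ('a, ((('a, 'm) heis \<Rightarrow> ('a, 'm) heis \<Rightarrow> ('a, 'm) heis) \<times>
           (('a, 'm) heis \<Rightarrow> ('a, 'm) heis)) set) module" where
  "H2_res lam = quotient_space scale2_res {c \<in> C2_res. d2_res lam c = 0} (d1_res lam ` C1)"

abbreviation fin_dim_over :: "('a::field, 'v) module \<Rightarrow> bool" where
  "fin_dim_over V \<equiv> vectorspace.fin_dim ring_of_type_algebra V"

abbreviation dim_over :: "('a::field, 'v) module \<Rightarrow> nat" where
  "dim_over V \<equiv> vectorspace.dim ring_of_type_algebra V"


section \<open>The cohomology spaces are well-defined quotient vector spaces\<close>

lemma quotient_space_vectorspace:
  fixes sc :: "'a::field \<Rightarrow> 'v::ab_group_add \<Rightarrow> 'v"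
  assumes "vector_space sc" "module.subspace sc Z" "module.subspace sc B" "B \<subseteq> Z"
  shows "vectorspace ring_of_type_algebra (quotient_space sc Z B)"
proof -
  interpret vector_space sc by fact
  define cs where "cs z = {z + b | b. b \<in> B}" for z
  have B0: "0 \<in> B" and Badd: "\<And>x y. x \<in> B \<Longrightarrow> y \<in> B \<Longrightarrow> x + y \<in> B"
    and Bsc: "\<And>a x. x \<in> B \<Longrightarrow> sc a x \<in> B"
    using assms(3) by (auto simp: subspace_def)
  have Bm: "\<And>x y. x \<in> B \<Longrightarrow> y \<in> B \<Longrightarrow> x - y \<in> B"
    using assms(3) subspace_diff by blast
  have Z0: "0 \<in> Z" and Zadd: "\<And>x y. x \<in> Z \<Longrightarrow> y \<in> Z \<Longrightarrow> x + y \<in> Z"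
    and Zsc: "\<And>a x. x \<in> Z \<Longrightarrow> sc a x \<in> Z"
    using assms(2) by (auto simp: subspace_def)
  have cs0: "B = cs 0" by (auto simp: cs_def)
  have memcs: "x \<in> cs z \<longleftrightarrow> x - z \<in> B" for x z
  proof
    assume "x - z \<in> B"
    thus "x \<in> cs z" unfolding cs_def by (auto intro!: exI[of _ "x - z"])
  qed (auto simp: cs_def)
  have csadd: "{x + y | x y. x \<in> cs u \<and> y \<in> cs v} = cs (u + v)" for u v
  proof safe
    fix x y assume "x \<in> cs u" "y \<in> cs v"
    hence "(x - u) + (y - v) \<in> B" by (auto simp: memcs intro: Badd)
    thus "x + y \<in> cs (u + v)" by (simp add: memcs algebra_simps)
  next
    fix x assume "x \<in> cs (u + v)"
    hence "x - v \<in> cs u" by (simp add: memcs algebra_simps)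
    moreover have "v \<in> cs v" by (simp add: memcs B0)
    ultimately show "\<exists>xa y. x = xa + y \<and> xa \<in> cs u \<and> y \<in> cs v"
      by (metis diff_add_cancel)
  qed
  have cssc: "{sc a x + b | x b. x \<in> cs u \<and> b \<in> B} = cs (sc a u)" for a u
  proof safe
    fix x b assume "x \<in> cs u" "b \<in> B"
    hence "sc a (x - u) + b \<in> B" by (auto simp: memcs intro: Badd Bsc)
    thus "sc a x + b \<in> cs (sc a u)" by (simp add: memcs algebra_simps scale_right_diff_distrib)
  next
    fix x assume "x \<in> cs (sc a u)"
    hence "x - sc a u \<in> B" by (simp add: memcs)
    moreover have "u \<in> cs u" by (simp add: memcs B0)
    ultimately show "\<exists>xa b. x = sc a xa + b \<and> xa \<in> cs u \<and> b \<in> B"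
      by (metis add.commute diff_add_cancel)
  qed
  have car: "carrier (quotient_space sc Z B) = cs ` Z"
    by (auto simp: quotient_space_def cs_def image_def)
  have zr: "\<zero>\<^bsub>quotient_space sc Z B\<^esub> = cs 0" by (simp add: quotient_space_def cs0)
  have ad: "cs u \<oplus>\<^bsub>quotient_space sc Z B\<^esub> cs v = cs (u + v)" for u v
    by (simp add: quotient_space_def csadd)
  have sm: "a \<odot>\<^bsub>quotient_space sc Z B\<^esub> cs v = cs (sc a v)" for a v
    by (simp add: quotient_space_def cssc)
  show ?thesis
  proof (rule vs_criteria)
    let ?Q = "quotient_space sc Z B"
    show "\<forall>v\<in>carrier ?Q. \<exists>neg_v\<in>carrier ?Q. v \<oplus>\<^bsub>?Q\<^esub> neg_v = \<zero>\<^bsub>?Q\<^esub>"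
    proof
      fix v assume "v \<in> carrier ?Q"
      then obtain u where u: "u \<in> Z" "v = cs u" by (auto simp: car)
      show "\<exists>neg_v\<in>carrier ?Q. v \<oplus>\<^bsub>?Q\<^esub> neg_v = \<zero>\<^bsub>?Q\<^esub>"
        using u assms(2) by (intro bexI[of _ "cs (- u)"]) (auto simp: ad zr car subspace_neg)
    qed
    show "field (ring_of_type_algebra :: 'a ring)" by (rule field_from_type_algebra)
  qed (auto simp: car zr ad sm ring_of_type_algebra_def algebra_simps
         intro!: imageI Zadd Zsc Z0 arg_cong[of _ _ cs])
qed

lemma heis_bracket_add: 
  "heis_bracket (x + y) z = heis_bracket x z + heis_bracket y z"
  "heis_bracket z (x + y) = heis_bracket z x + heis_bracket z y"
  unfolding heis_bracket_def vec.scale_left_distrib[symmetric] sum.distrib[symmetric]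
  by (simp_all add: algebra_simps)

lemma heis_bracket_scale:
  "heis_bracket (a *s x) z = a *s heis_bracket x z"
  "heis_bracket z (a *s x) = a *s heis_bracket z x"
  unfolding heis_bracket_def vector_smult_assoc sum_distrib_left
  by (simp_all add: algebra_simps)

lemma heis_bracket_zero [simp]: "heis_bracket 0 z = 0" "heis_bracket z 0 = 0"
  by (simp_all add: heis_bracket_def)

lemma heis_bracket_minus:
  "heis_bracket (- x) z = - heis_bracket x z" "heis_bracket z (- x) = - heis_bracket z x"
  using heis_bracket_scale(1)[where a="-1" and x=x and z=z] heis_bracket_scale(2)[where a="-1" and x=x and z=z] by simp_all

lemma heis_bracket_diff:
  "heis_bracket (x - y) z = heis_bracket x z - heis_bracket y z"
  "heis_bracket z (x - y) = heis_bracket z x - heis_bracket z y"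
  using heis_bracket_add(1)[where x=x and y="- y" and z=z] heis_bracket_add(2)[where x=x and y="- y" and z=z] by (simp_all add: heis_bracket_minus)

lemma heis_bracket_self [simp]: "heis_bracket x x = 0"
  by (simp add: heis_bracket_def mult.commute)

lemma heis_bracket_commute: "heis_bracket x y = - heis_bracket y x"
proof -
  have "(\<Sum>i\<in>UNIV. x $ Some (Inl i) * y $ Some (Inr i) - x $ Some (Inr i) * y $ Some (Inl i)) =
      - (\<Sum>i\<in>UNIV. y $ Some (Inl i) * x $ Some (Inr i) - y $ Some (Inr i) * x $ Some (Inl i))"
    by (simp add: sum_subtractf mult.commute)
  thus ?thesis unfolding heis_bracket_def by (simp only: vec.scale_minus_left)
qed

lemma heis_bracket_central [simp]:
  "heis_bracket (c *s axis None 1) z = 0" "heis_bracket z (c *s axis None 1) = 0"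
  by (simp_all add: heis_bracket_def axis_def)

lemma heis_bracket_bracket [simp]:
  "heis_bracket (heis_bracket x y) z = 0" "heis_bracket z (heis_bracket x y) = 0"
  by (simp_all add: heis_bracket_def[of x y])

lemma heis_bracket_pmap [simp]:
  "heis_bracket (heis_pmap lam x) z = 0" "heis_bracket z (heis_pmap lam x) = 0"
  by (simp_all add: heis_pmap_def)

lemma heis_ad_zero [simp]: "(heis_bracket g ^^ n) 0 = 0"
  by (induction n) auto

lemma heis_ad_ge2: "(heis_bracket g ^^ n) x = 0" if n2: "n \<ge> 2"
proof (cases n)
  case (Suc k)
  then obtain l where "k = Suc l" using n2 Suc by (cases k) auto
  with Suc show ?thesis by simp
qed (use n2 in simp)

lemma linear_vec_iff:
  fixes f :: "'a::field ^ 'k::finite \<Rightarrow> 'a ^ 'l::finite"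
  shows "Vector_Spaces.linear (*s) (*s) f \<longleftrightarrow>
    (\<forall>x y. f (x + y) = f x + f y) \<and> (\<forall>a x. f (a *s x) = a *s f x)"
  by (auto simp: Vector_Spaces.linear_iff vec.vector_space_axioms)

lemma C1D:
  assumes "\<psi> \<in> C1"
  shows "\<psi> (x + y) = \<psi> x + \<psi> y" "\<psi> (a *s x) = a *s \<psi> x" "\<psi> 0 = 0"
    "\<psi> (- x) = - \<psi> x" "\<psi> (x - y) = \<psi> x - \<psi> y"
proof -
  have 1: "\<psi> (x + y) = \<psi> x + \<psi> y" "\<psi> (a *s x) = a *s \<psi> x" for x y a
    using assms by (auto simp: C1_def linear_vec_iff)
  show "\<psi> (x + y) = \<psi> x + \<psi> y" "\<psi> (a *s x) = a *s \<psi> x" by (rule 1)+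
  show "\<psi> 0 = 0" using 1(2)[of 0 0] by simp
  show 2: "\<psi> (- x) = - \<psi> x" for x using 1(2)[of "-1" x] by simp
  show "\<psi> (x - y) = \<psi> x - \<psi> y" using 1(1)[of x "- y"] by (simp add: 2)
qed

lemma CHAR_ge2: "CHAR('a::field) \<ge> 2" if "CHAR('a) > 0"
  using prime_CHAR_semidom[OF that] by (rule prime_ge_2_nat)

lemma range_d0_subset_ker:
  assumes "CHAR('a::field) > 0"
  shows "range (d0 :: ('a, 'm::finite) heis \<Rightarrow> _) \<subseteq> {\<psi> \<in> C1. d1_res lam \<psi> = 0}"
proof safe
  fix x :: "('a, 'm) heis"
  have p: "CHAR('a) \<ge> 2" by (rule CHAR_ge2) fact
  show "d0 x \<in> C1"
    by (simp add: C1_def d0_def linear_vec_iff heis_bracket_add heis_bracket_scale)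
  have "(heis_bracket g ^^ (CHAR('a) - Suc 0)) (heis_bracket x g) = 0" for g
    using p by (cases "CHAR('a) - Suc 0") (auto simp: funpow_swap1)
  then show "d1_res lam (d0 x) = 0"
    by (auto simp: d1_res_def d1_def ind1_def d0_def fun_eq_iff zero_prod_def)
qed

lemma d1_in_C2: "d1 \<psi> \<in> C2" if "\<psi> \<in> C1"
  by (auto simp: C2_def linear_vec_iff d1_def heis_bracket_add heis_bracket_scale C1D[OF that]
       vec.scale_right_diff_distrib)

lemma pmap_scale: "heis_pmap lam (a *s g) = a ^ CHAR('a) *s heis_pmap lam (g :: ('a::field, 'm::finite) heis)"
  by (auto simp: heis_pmap_def vector_smult_assoc sum_distrib_left distrib_left power_mult_distrib power2_eq_square
        mult_ac intro!: sum.cong)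

lemma ad_scale: "(heis_bracket (a *s g) ^^ n) x = a ^ n *s (heis_bracket g ^^ n) x"
  by (induction n) (auto simp: heis_bracket_scale vector_smult_assoc mult_ac)

lemma CHAR2:
  assumes "CHAR('a::field) = 2"
  shows "- x = (x :: 'a)" "y - x = y + x"
proof -
  have "(2::'a) = 0" using of_nat_CHAR[where 'a='a] unfolding assms of_nat_numeral .
  hence *: "x + x = 0" using mult_2[of x] by simp
  show "- x = x" using * by (rule minus_unique)
  show "y - x = y + x" using * by (simp add: diff_eq_eq add.assoc)
qed

lemma CHAR2_vec:
  assumes "CHAR('a::field) = 2"
  shows "- x = (x :: 'a ^ 'k)" "y - x = y + x"
  by (simp_all add: vec_eq_iff CHAR2[OF assms])

lemma pmap_add:
  fixes g h :: "('a::field, 'm::finite) heis"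
  assumes "CHAR('a) > 0"
  shows "heis_pmap lam (g + h) = heis_pmap lam g + heis_pmap lam h +
     (if CHAR('a) = 2 then heis_bracket g h else 0)"
proof -
  have p: "prime CHAR('a)" using prime_CHAR_semidom[OF assms] .
  have 1: "(\<Sum>k\<in>UNIV. ((g + h) $ k) ^ CHAR('a) * lam $ k) =
      (\<Sum>k\<in>UNIV. (g $ k) ^ CHAR('a) * lam $ k) + (\<Sum>k\<in>UNIV. (h $ k) ^ CHAR('a) * lam $ k)"
    by (simp add: freshmans_dream[OF p refl] distrib_right sum.distrib)
  show ?thesis
  proof (cases "CHAR('a) = 2")
    case True
    show ?thesis unfolding heis_pmap_def 1 using True
      by (simp add: heis_bracket_def CHAR2[OF True] sum.distrib vec.scale_left_distrib distrib_left distrib_right mult_ac add_ac)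
  next
    case False
    thus ?thesis unfolding heis_pmap_def 1 by (simp add: vec.scale_left_distrib)
  qed
qed

lemma left_normed_ge2:
  fixes xs :: "('a::field, 'm::finite) heis list"
  shows "length xs \<ge> 2 \<Longrightarrow> \<exists>c. left_normed xs = c *s axis None 1"
proof -
  have *: "\<exists>c. foldl heis_bracket (c0 *s axis None 1) ys = c *s axis None 1"
    for c0 and ys :: "('a, 'm) heis list"
    by (induction ys arbitrary: c0) (auto, metis vec.scale_zero_left)
  assume "length xs \<ge> 2"
  then obtain x y ys where "xs = x # y # ys" by (cases xs; cases "tl xs") auto
  thus ?thesis using * by (auto simp: heis_bracket_def[of x y])
qed

lemma left_normed_ge3:
  fixes xs :: "('a::field, 'm::finite) heis list"
  shows "length xs \<ge> 3 \<Longrightarrow> left_normed xs = 0"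
proof -
  have *: "foldl heis_bracket 0 ys = 0" for ys :: "('a, 'm) heis list"
    by (induction ys) auto
  assume "length xs \<ge> 3"
  then obtain x y z ys where "xs = x # y # z # ys"
    by (cases xs; cases "tl xs"; cases "tl (tl xs)") auto
  thus ?thesis using * by auto
qed

lemma d1_compat_term:
  fixes xs :: "('a::field, 'm::finite) heis list"
  assumes "CHAR('a) > 2" "length xs = CHAR('a)" "\<psi> \<in> C1"
  shows "compat_term (d1 \<psi>) xs = 0"
proof (cases "CHAR('a) = 3")
  case True
  then obtain x y z where "xs = [x, y, z]" using assms(2)
    by (auto simp: length_Suc_conv eval_nat_numeral)
  thus ?thesis using True
    by (simp add: compat_term_def d1_def heis_bracket_add heis_bracket_diff heis_bracket_minus C1D[OF assms(3)])
next
  case False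
  hence p: "CHAR('a) \<ge> 4" using assms(1) by simp
  have 1: "left_normed (take (CHAR('a) - 1) xs) = 0"
    using p assms(2) by (intro left_normed_ge3) simp
  obtain c where c: "left_normed (take (CHAR('a) - 2) xs) = c *s axis None 1"
    using left_normed_ge2[of "take (CHAR('a) - 2) xs"] p assms(2) by fastforce
  have "heis_bracket z (d1 \<psi> (c *s axis None 1) y) = 0" for y z
    by (simp add: d1_def heis_bracket_diff heis_bracket_minus C1D(3)[OF assms(3)])
  with 1 c show ?thesis using p
    by (simp add: compat_term_def Let_def d1_def C1D(3)[OF assms(3)])
qed

lemma d1_res_subset_ker:
  assumes "CHAR('a::field) > 0"
  shows "d1_res lam ` C1 \<subseteq> {c \<in> C2_res. d2_res (lam :: ('a, 'm::finite) heis) c = 0}"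
proof (rule image_subsetI, rule CollectI, rule conjI)
  fix \<psi> :: "('a, 'm) heis \<Rightarrow> ('a, 'm) heis"
  assume psi: "\<psi> \<in> C1"
  have p: "CHAR('a) \<ge> 2" by (rule CHAR_ge2) fact
  note br = heis_bracket_add heis_bracket_diff heis_bracket_minus C1D[OF psi]
  have "compatible (d1 \<psi>) (- ind1 lam \<psi>)"
  proof (cases "CHAR('a) = 2")
    case True
    have "{s. length s = 2 \<and> s ! 0 = True \<and> s ! 1 = False} = {[True, False]}"
      by (auto simp: length_Suc_conv eval_nat_numeral)
    note calculation = this
    note m = CHAR2_vec(1)[OF True] and m' = CHAR2_vec(2)[OF True]
    show ?thesis unfolding compatible_def
    proof (intro conjI allI)
      fix a g show "(- ind1 lam \<psi>) (a *s g) = a ^ CHAR('a) *s (- ind1 lam \<psi>) g"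
        using True by (simp add: ind1_def br pmap_scale heis_bracket_scale m m' vector_smult_assoc power2_eq_square vec.scale_right_distrib)
    next
      fix g h
      show "(- ind1 lam \<psi>) (g + h) = (- ind1 lam \<psi>) g + (- ind1 lam \<psi>) h +
        (\<Sum>s\<in>{s. length s = CHAR('a) \<and> s ! 0 = True \<and> s ! 1 = False}.
           inverse (of_nat (count_list s True)) *s
             compat_term (d1 \<psi>) (map (\<lambda>b. if b then g else h) s))"
        using True calculation
        by (simp add: ind1_def compat_term_def d1_def br pmap_add assms m m' add_ac)
    qed
  next
    case False
    hence p3: "CHAR('a) > 2" using p by simp
    have ad0: "(heis_bracket g ^^ (CHAR('a) - Suc 0)) x = 0" for g x :: "('a, 'm) heis"
      using p3 by (intro heis_ad_ge2) simp
    have z: "(\<Sum>s\<in>{s. length s = CHAR('a) \<and> s ! 0 = True \<and> s ! 1 = False}.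
           inverse (of_nat (count_list s True)) *s
             compat_term (d1 \<psi>) (map (\<lambda>b. if b then g else h) s)) = 0" for g h
      by (intro sum.neutral) (auto simp: d1_compat_term[OF p3 _ psi])
    show ?thesis unfolding compatible_def z
      by (auto simp: ind1_def pmap_scale pmap_add assms False ad0 br)
  qed
  thus "d1_res lam \<psi> \<in> C2_res" by (simp add: d1_res_def C2_res_def d1_in_C2 psi)
  have "d2 (d1 \<psi>) = 0"
    by (simp add: fun_eq_iff d2_def d1_def br)
  moreover have "ind2 lam (d1 \<psi>) (- ind1 lam \<psi>) = 0"
  proof (cases "CHAR('a) = 2")
    case True
    thus ?thesis by (auto simp: fun_eq_iff ind2_def d1_def ind1_def br)
  next
    case False
    have ad0: "(heis_bracket g ^^ (CHAR('a) - 1)) x = 0" for g x :: "('a, 'm) heis"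
      using p False by (intro heis_ad_ge2) simp
    have "\<exists>n. CHAR('a) - 2 = Suc n" using p False by presburger
    then obtain n where n: "CHAR('a) - 2 = Suc n" by blast
    have ad1: "(heis_bracket h ^^ (CHAR('a) - 2)) g = heis_bracket h ((heis_bracket h ^^ n) g)"
      for g h :: "('a, 'm) heis"
      unfolding n by simp
    show ?thesis
    proof (intro ext)
      fix g h
      show "ind2 lam (d1 \<psi>) (- ind1 lam \<psi>) g h = 0 g h"
        unfolding ind2_def ad0 ad1 by (simp add: d1_def ind1_def br ad0[unfolded One_nat_def])
    qed
  qed
  ultimately show "d2_res lam (d1_res lam \<psi>) = 0"
    by (simp add: d2_res_def d1_res_def zero_prod_def)
qed

lemma vector_space_scale1: "vector_space (scale1 :: 'a::field \<Rightarrow> (('a, 'm::finite) heis \<Rightarrow> _) \<Rightarrow> _)"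
  by unfold_locales
    (simp_all add: scale1_def fun_eq_iff vec.scale_right_distrib vec.scale_left_distrib)

lemma vector_space_scale2_res:
  "vector_space (scale2_res :: 'a::field \<Rightarrow>
     ((('a, 'm::finite) heis \<Rightarrow> ('a, 'm) heis \<Rightarrow> ('a, 'm) heis) \<times> (('a, 'm) heis \<Rightarrow> ('a, 'm) heis)) \<Rightarrow> _)"
  by unfold_locales
    (auto simp: scale2_res_def fun_eq_iff vec.scale_right_distrib vec.scale_left_distrib)

lemma d1_lin: "d1 (\<psi> + \<xi>) = d1 \<psi> + d1 \<xi>" "d1 (scale1 a \<psi>) = (\<lambda>g h. a *s d1 \<psi> g h)"
  by (auto simp: d1_def fun_eq_iff scale1_def heis_bracket_add heis_bracket_scale
      vec.scale_right_diff_distrib)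

lemma ad_add: "(heis_bracket g ^^ n) (x + y) = (heis_bracket g ^^ n) x + (heis_bracket g ^^ n) y"
  by (induction n) (auto simp: heis_bracket_add)

lemma ad_scale2: "(heis_bracket g ^^ n) (a *s x) = a *s (heis_bracket g ^^ n) x"
  by (induction n) (auto simp: heis_bracket_scale)

lemma ind1_lin: "ind1 lam (\<psi> + \<xi>) = ind1 lam \<psi> + ind1 lam \<xi>"
    "ind1 lam (scale1 a \<psi>) = (\<lambda>g. a *s ind1 lam \<psi> g)"
  by (auto simp: ind1_def fun_eq_iff scale1_def ad_add ad_scale2 vec.scale_right_diff_distrib)

lemma d1_res_lin: "d1_res lam (\<psi> + \<xi>) = d1_res lam \<psi> + d1_res lam \<xi>"
    "d1_res lam (scale1 a \<psi>) = scale2_res a (d1_res lam \<psi>)"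
  by (auto simp: d1_res_def d1_lin ind1_lin scale2_res_def fun_eq_iff)

lemma subspace_C1: "module.subspace scale1 C1"
proof -
  interpret vector_space scale1 by (rule vector_space_scale1)
  show ?thesis
    by (auto simp: subspace_def C1_def linear_vec_iff scale1_def vec.scale_right_distrib
       vector_smult_assoc mult_ac)
qed

lemma subspace_Z1: "module.subspace scale1 {\<psi> \<in> C1. d1_res lam \<psi> = 0}"
proof -
  interpret vector_space scale1 by (rule vector_space_scale1)
  interpret v2: vector_space scale2_res by (rule vector_space_scale2_res)
  have "d1_res lam 0 = 0" using d1_res_lin(2)[of lam 0 0] by simp
  thus ?thesis using subspace_C1
    by (auto simp: subspace_def d1_res_lin)
qed

lemma subspace_range_d0:
  "module.subspace scale1 (range (d0 :: ('a::field, 'm::finite) heis \<Rightarrow> _))"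
proof -
  interpret vector_space "scale1 :: 'a \<Rightarrow> (('a, 'm) heis \<Rightarrow> _) \<Rightarrow> _" by (rule vector_space_scale1)
  have 1: "0 = d0 0" "d0 x + d0 y = d0 (x + y)" "scale1 c (d0 x) = d0 (c *s x)"
    for x y :: "('a, 'm) heis" and c
    by (auto simp: d0_def fun_eq_iff heis_bracket_add heis_bracket_scale scale1_def)
  have "0 \<in> range (d0 :: ('a, 'm) heis \<Rightarrow> _)" by (subst 1(1)) (rule rangeI)
  thus ?thesis unfolding subspace_def by (auto simp: 1(2,3))
qed

lemma subspace_B2: "module.subspace scale2_res (d1_res lam ` C1)"
proof -
  interpret vector_space scale1 by (rule vector_space_scale1)
  interpret v2: vector_space scale2_res by (rule vector_space_scale2_res)
  have "d1_res lam 0 = 0" using d1_res_lin(2)[of lam 0 0] by simp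
  hence 0: "0 \<in> d1_res lam ` C1"
    using imageI[OF subspace_0[OF subspace_C1], of "d1_res lam"] by simp
  have 1: "d1_res lam \<psi> + d1_res lam \<xi> \<in> d1_res lam ` C1" if "\<psi> \<in> C1" "\<xi> \<in> C1" for \<psi> \<xi>
    using imageI[OF subspace_add[OF subspace_C1 that], of "d1_res lam"] by (simp only: d1_res_lin)
  have 2: "scale2_res c (d1_res lam \<psi>) \<in> d1_res lam ` C1" if "\<psi> \<in> C1" for \<psi> c
    using imageI[OF subspace_scale[OF subspace_C1 that], of "d1_res lam"] by (simp only: d1_res_lin)
  show ?thesis
  proof (rule v2.subspaceI)
    fix x y assume "x \<in> d1_res lam ` C1" "y \<in> d1_res lam ` C1"
    thus "x + y \<in> d1_res lam ` C1" by (elim imageE) (simp only: 1)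
  next
    fix c x assume "x \<in> d1_res lam ` C1"
    thus "scale2_res c x \<in> d1_res lam ` C1" by (elim imageE) (simp only: 2)
  qed (rule 0)
qed

lemma compat_term_lin:
  "compat_term (\<phi> + \<xi>) xs = compat_term \<phi> xs + compat_term \<xi> xs"
  "compat_term (\<lambda>g h. a *s \<phi> g h) xs = a *s compat_term \<phi> xs"
  by (auto simp: compat_term_def Let_def heis_bracket_add heis_bracket_scale vec.scale_right_diff_distrib)

lemma compat_term_zero: "compat_term 0 xs = 0"
  by (simp add: compat_term_def Let_def)

lemma subspace_C2_res: "module.subspace scale2_res C2_res"
proof -
  interpret v2: vector_space scale2_res by (rule vector_space_scale2_res)
  have "\<phi> + \<xi> \<in> C2" "(\<lambda>g h. a *s \<phi> g h) \<in> C2" if "\<phi> \<in> C2" "\<xi> \<in> C2" for \<phi> \<xi> a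
    using that by (auto simp: C2_def linear_vec_iff vec.scale_right_distrib vector_smult_assoc mult_ac)
  moreover have "compatible (\<phi> + \<xi>) (\<omega> + \<eta>)" "compatible (\<lambda>g h. a *s \<phi> g h) (\<lambda>g. a *s \<omega> g)"
    if "compatible \<phi> \<omega>" "compatible \<xi> \<eta>" for \<phi> \<xi> \<omega> \<eta> a
    using that unfolding compatible_def
    by (auto simp: compat_term_lin vec.scale_right_distrib sum.distrib vector_smult_assoc mult_ac
         vec.scale_sum_right add_ac)
  moreover have "(0, 0) \<in> C2_res"
    by (simp add: C2_res_def C2_def linear_vec_iff compatible_def compat_term_zero)
  ultimately show ?thesis
    unfolding v2.subspace_def by (auto simp: C2_res_def scale2_res_def zero_prod_def)
qed

lemma d2_res_lin:
  assumes "d2_res lam c = 0" "d2_res lam c' = 0"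
  shows "d2_res lam (c + c') = 0" "d2_res lam (scale2_res a c) = 0"
proof -
  have s: "d2 (\<phi> + \<xi>) = d2 \<phi> + d2 \<xi>" "ind2 lam (\<phi> + \<xi>) (\<omega> + \<eta>) = ind2 lam \<phi> \<omega> + ind2 lam \<xi> \<eta>"
     "d2 (\<lambda>g h. a *s \<phi> g h) = (\<lambda>g h k. a *s d2 \<phi> g h k)"
     "ind2 lam (\<lambda>g h. a *s \<phi> g h) (\<lambda>g. a *s \<omega> g) = (\<lambda>g h. a *s ind2 lam \<phi> \<omega> g h)"
    for \<phi> \<xi> \<omega> \<eta>
    by (auto simp: d2_def ind2_def fun_eq_iff heis_bracket_add heis_bracket_scale
        vec.scale_right_diff_distrib vec.scale_right_distrib)
  show "d2_res lam (c + c') = 0" using assms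
    by (cases c; cases c') (simp add: d2_res_def s zero_prod_def)
  show "d2_res lam (scale2_res a c) = 0" using assms
    by (cases c) (simp add: d2_res_def scale2_res_def s zero_prod_def fun_eq_iff)
qed

lemma subspace_Z2: "module.subspace scale2_res {c \<in> C2_res. d2_res lam c = 0}"
proof -
  interpret v2: vector_space scale2_res by (rule vector_space_scale2_res)
  have "d2_res lam 0 = 0"
    by (simp add: d2_res_def d2_def ind2_def zero_prod_def fun_eq_iff)
  thus ?thesis
    by (intro v2.subspaceI)
      (simp_all add: d2_res_lin v2.subspace_0[OF subspace_C2_res] v2.subspace_add[OF subspace_C2_res]
        v2.subspace_scale[OF subspace_C2_res])
qed

lemma vectorspace_H1_res:
  assumes "CHAR('a::field) > 0"
  shows "vectorspace ring_of_type_algebra (H1_res (lam :: ('a, 'm::finite) heis))"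
  unfolding H1_res_def
  by (intro quotient_space_vectorspace vector_space_scale1 subspace_Z1 subspace_range_d0
      range_d0_subset_ker assms)

lemma vectorspace_H2_res:
  assumes "CHAR('a::field) > 0"
  shows "vectorspace ring_of_type_algebra (H2_res (lam :: ('a, 'm::finite) heis))"
  unfolding H2_res_def
  by (intro quotient_space_vectorspace vector_space_scale2_res subspace_Z2 subspace_B2
      d1_res_subset_ker assms)

end

theory Submission
  imports Defs
begin

text \<open>
  Write \<open>z\<close> for the central basis vector, \<open>V\<close> for the span of the \<open>n = 2m\<close> other basis vectors and
  \<open>[x, y] = B(x, y) z\<close>, so that \<open>B\<close> is a symplectic form on \<open>V\<close> with \<open>z\<close> in its radical. Both
  dimensions are read off from explicit complete invariants of cohomology classes: a linear map from
  the cocycles onto a coordinate space whose kernel is the space of coboundaries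
  (\<open>quotient_space_dim\<close>).

  First cohomology. A derivation \<open>\<psi>\<close> satisfies \<open>\<psi>(z) = \<mu> z\<close>, and the bilinear form
  \<open>S(g, h) = B(h, \<psi>(g))\<close> on \<open>V\<close> satisfies \<open>S(h, g) - S(g, h) = \<mu> B(g, h)\<close>; the inner derivations are
  those with \<open>S = 0\<close> and \<open>\<mu> = 0\<close>. So the class is given by \<open>\<mu>\<close> and half of the matrix of \<open>S\<close>. The
  \<open>p\<close>-map adds the condition \<open>\<mu> \<lambda> = 0\<close> for \<open>p > 2\<close>. For \<open>p = 2\<close> it prescribes the diagonal of \<open>S\<close> and
  asks for \<open>\<mu> \<lambda>\<^sub>2\<^sub>m\<^sub>+\<^sub>1 = 0\<close> (\<open>ker_d1_res_iff\<close>).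

  Second cohomology. For an ordinary cocycle \<open>\<phi>\<close> and \<open>m > 1\<close> one has \<open>\<phi>(z, g) = b(g) z\<close>, and the form
  \<open>B(g, h) b(k) - B(k, \<phi>(g, h))\<close> (\<open>hook_form\<close>) vanishes when an argument is \<open>z\<close>, is alternating in
  \<open>g, h\<close>, and has cyclic sum \<open>0\<close>. It vanishes on coboundaries, and every form of this kind occurs.
  These forms make up the kernel of \<open>V\<^sup>* \<otimes> \<Lambda>\<^sup>2 V\<^sup>* \<rightarrow> \<Lambda>\<^sup>3 V\<^sup>*\<close>, of dimension \<open>n(n\<^sup>2 - 1)/3\<close>, which is
  \<open>8/3 m\<^sup>3 - 2/3 m\<close>. The kernel is the image of \<open>S\<^sup>2 V\<^sup>* \<otimes> V\<^sup>*\<close> under the Koszul map, and this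
  presentation yields a companion \<open>\<omega>\<close> in every characteristic (\<open>koszul_restricted\<close>): the delicate
  cases are \<open>p = 2\<close> and \<open>p = 3\<close>, where \<open>\<omega>\<close> needs a quadratic or a cubic term.

  If the hook form is \<open>0\<close>, a coboundary reduces \<open>(\<phi>, \<omega>)\<close> to \<open>(0, \<omega>)\<close>, where \<open>\<omega>\<close> is a \<open>p\<close>-semilinear map
  into the centre, that is, a vector of \<open>F\<^sup>n\<^sup>+\<^sup>1\<close> (\<open>cocycle_is_coboundary\<close>). The remaining
  coboundaries come from derivations. For \<open>p > 2\<close> they form the span of \<open>\<lambda>\<close>, which leaves \<open>n + 1\<close> or \<open>n\<close>
  dimensions. For \<open>p = 2\<close> the diagonal of \<open>S\<close> kills the \<open>n\<close> coordinates of \<open>V\<close>, and the last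
  coordinate survives exactly if \<open>\<lambda>\<^sub>2\<^sub>m\<^sub>+\<^sub>1 = 0\<close>.
\<close>

no_notation fps_nth (infixl "$" 75)


section \<open>Dimensions of quotients\<close>

text \<open>
  The form in which all dimensions are computed: the \<open>f z i\<close> with \<open>i \<in> I\<close> are coordinates on \<open>Z / B\<close>,
  because \<open>f\<close> maps \<open>Z\<close> onto \<open>I \<rightarrow> F\<close> with kernel \<open>B\<close>.
\<close>

lemma quotient_space_dim:
  fixes sc :: "'a::field \<Rightarrow> 'v::ab_group_add \<Rightarrow> 'v" and f :: "'v \<Rightarrow> 'i \<Rightarrow> 'a"
  assumes vs: "vector_space sc" and Z: "module.subspace sc Z" and B: "module.subspace sc B"
    and sub: "B \<subseteq> Z" and fin: "finite I"
    and f_add: "\<And>x y i. f (x + y) i = f x i + f y i"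
    and f_sc: "\<And>a x i. f (sc a x) i = a * f x i"
    and ker: "\<And>z. z \<in> Z \<Longrightarrow> (\<forall>i\<in>I. f z i = 0) \<longleftrightarrow> z \<in> B"
    and surj: "\<And>c. \<exists>z\<in>Z. \<forall>i\<in>I. f z i = c i"
  shows "fin_dim_over (quotient_space sc Z B) \<and> dim_over (quotient_space sc Z B) = card I"
proof -
  interpret vector_space sc by fact
  let ?Q = "quotient_space sc Z B" and ?R = "ring_of_type_algebra :: 'a ring"
  interpret Q: vectorspace ?R ?Q by (rule quotient_space_vectorspace[OF vs Z B sub])
  define cs where "cs z = {z + b | b. b \<in> B}" for z
  have memcs: "x \<in> cs z \<longleftrightarrow> x - z \<in> B" for x z
  proof
    assume "x - z \<in> B"
    thus "x \<in> cs z" unfolding cs_def by (auto intro!: exI[of _ "x - z"])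
  qed (auto simp: cs_def)
  have cs_eq: "cs x = cs y \<longleftrightarrow> x - y \<in> B" for x y
  proof
    assume "cs x = cs y"
    moreover have "x \<in> cs x" using B by (simp add: memcs subspace_0)
    ultimately show "x - y \<in> B" using memcs by blast
  next
    assume *: "x - y \<in> B"
    show "cs x = cs y"
    proof (rule Set.set_eqI)
      fix w :: 'v
      have "w - y = (w - x) + (x - y)" "w - x = (w - y) - (x - y)" by simp_all
      thus "w \<in> cs x \<longleftrightarrow> w \<in> cs y"
        unfolding memcs using * B by (metis subspace_add subspace_diff)
    qed
  qed
  have car: "carrier ?Q = cs ` Z"
    by (auto simp: quotient_space_def cs_def image_def)
  have zr: "\<zero>\<^bsub>?Q\<^esub> = cs 0" by (simp add: quotient_space_def cs_def)
  have ad: "cs u \<oplus>\<^bsub>?Q\<^esub> cs v = cs (u + v)" for u v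
  proof -
    have "{x + y | x y. x \<in> cs u \<and> y \<in> cs v} = cs (u + v)"
    proof safe
      fix x y assume "x \<in> cs u" "y \<in> cs v"
      hence "(x - u) + (y - v) \<in> B" using B by (auto simp: memcs intro: subspace_add)
      thus "x + y \<in> cs (u + v)" by (simp add: memcs algebra_simps)
    next
      fix x assume "x \<in> cs (u + v)"
      hence "x - v \<in> cs u" by (simp add: memcs algebra_simps)
      moreover have "v \<in> cs v" using B by (simp add: memcs subspace_0)
      ultimately show "\<exists>xa y. x = xa + y \<and> xa \<in> cs u \<and> y \<in> cs v"
        by (metis diff_add_cancel)
    qed
    thus ?thesis by (simp add: quotient_space_def)
  qed
  have sm: "a \<odot>\<^bsub>?Q\<^esub> cs u = cs (sc a u)" for a u
  proof -
    have "{sc a x + b | x b. x \<in> cs u \<and> b \<in> B} = cs (sc a u)"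
    proof safe
      fix x b assume "x \<in> cs u" "b \<in> B"
      hence "sc a (x - u) + b \<in> B" using B by (auto simp: memcs intro: subspace_add subspace_scale)
      thus "sc a x + b \<in> cs (sc a u)" by (simp add: memcs algebra_simps scale_right_diff_distrib)
    next
      fix x assume "x \<in> cs (sc a u)"
      hence "x - sc a u \<in> B" by (simp add: memcs)
      moreover have "u \<in> cs u" using B by (simp add: memcs subspace_0)
      ultimately show "\<exists>xa b. x = sc a xa + b \<and> xa \<in> cs u \<and> b \<in> B"
        by (metis add.commute diff_add_cancel)
    qed
    thus ?thesis by (simp add: quotient_space_def)
  qed
  have carR: "carrier ?R = UNIV" and zeroR: "\<zero>\<^bsub>?R\<^esub> = 0"
    by (simp_all add: ring_of_type_algebra_def)
  have f0: "f 0 i = 0" for i using f_sc[of 0 0 i] by simp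
  have f_neg: "f (- x) i = - f x i" for x i
    using f_add[of x "- x" i] by (simp add: f0 eq_neg_iff_add_eq_0 add.commute)
  have f_diff: "f (x - y) i = f x i - f y i" for x y i
    using f_add[of x "- y" i] by (simp add: f_neg)
  \<comment> \<open>The cosets of preimages of the standard basis vectors form a basis.\<close>
  have "\<exists>w. \<forall>i. w i \<in> Z \<and> (\<forall>j\<in>I. f (w i) j = (if j = i then 1 else 0))"
    using surj[of "\<lambda>j. if j = _ then 1 else 0"] by (intro choice allI) blast
  then obtain w where wZ: "\<And>i. w i \<in> Z"
    and fw: "\<And>i j. j \<in> I \<Longrightarrow> f (w i) j = (if j = i then 1 else 0)" by blast
  define e where "e i = cs (w i)" for i
  have inj: "inj_on e I"
  proof (rule inj_onI)
    fix i j assume ij: "i \<in> I" "j \<in> I" "e i = e j"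
    hence "w i - w j \<in> B" by (simp add: e_def cs_eq)
    moreover from this have "w i - w j \<in> Z" using sub by blast
    ultimately have "f (w i - w j) i = 0" using ker ij(1) by blast
    thus "i = j" using ij by (auto simp: f_diff fw split: if_splits)
  qed
  have eQ: "e ` I \<subseteq> carrier ?Q" using wZ by (auto simp: car e_def)
  have lc: "Q.lincomb a (e ` A) = cs (\<Sum>i\<in>A. sc (a (e i)) (w i)) \<and>
      (\<Sum>i\<in>A. sc (a (e i)) (w i)) \<in> Z" if "A \<subseteq> I" for a A
    using finite_subset[OF that fin] that
  proof (induction A rule: finite_induct)
    case empty
    show ?case using Z by (simp add: Q.lincomb_empty zr subspace_0)
  next
    case (insert i A)
    have A: "A \<subseteq> I" "i \<in> I" using insert.prems by auto
    have "e i \<notin> e ` A"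
      using inj insert.hyps A by (auto dest: inj_onD)
    moreover have "e i \<in> carrier ?Q" "e ` A \<subseteq> carrier ?Q" using eQ A by auto
    ultimately have "Q.lincomb a (e ` insert i A) = a (e i) \<odot>\<^bsub>?Q\<^esub> e i \<oplus>\<^bsub>?Q\<^esub> Q.lincomb a (e ` A)"
      using insert.hyps by (simp only: image_insert) (rule Q.lincomb_insert2, auto simp: carR)
    also have "\<dots> = cs (\<Sum>i\<in>insert i A. sc (a (e i)) (w i))"
      using insert.IH[OF A(1)] insert.hyps by (simp add: e_def[of i] sm ad)
    finally show ?case
      using insert.IH[OF A(1)] insert.hyps Z wZ by (simp add: subspace_add subspace_scale)
  qed
  have fsum: "f (\<Sum>i\<in>A. sc (a i) (w i)) j = (\<Sum>i\<in>A. a i * f (w i) j)" for a A j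
    by (induction A rule: infinite_finite_induct) (simp_all add: f0 f_add f_sc)
  have fsum': "f (\<Sum>i\<in>I. sc (a i) (w i)) j = a j" if "j \<in> I" for a j
    unfolding fsum using that fin by (simp add: fw if_distrib[of "(*) _"] cong: if_cong)
  have gen: "carrier ?Q \<subseteq> Q.span (e ` I)"
  proof
    fix v assume "v \<in> carrier ?Q"
    then obtain z where z: "z \<in> Z" "v = cs z" by (auto simp: car)
    define a where "a q = f z (the_inv_into I e q)" for q
    have ae: "a (e i) = f z i" if "i \<in> I" for i
      using that inj by (simp add: a_def the_inv_into_f_f)
    have 1: "(\<Sum>i\<in>I. sc (a (e i)) (w i)) \<in> Z"
      "Q.lincomb a (e ` I) = cs (\<Sum>i\<in>I. sc (a (e i)) (w i))"
      using lc[of I a] by auto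
    have "z - (\<Sum>i\<in>I. sc (a (e i)) (w i)) \<in> B"
      by (subst ker[symmetric]) (use z 1 Z in \<open>auto simp: f_diff fsum' ae subspace_diff\<close>)
    hence "v = Q.lincomb a (e ` I)" unfolding z 1 cs_eq .
    thus "v \<in> Q.span (e ` I)" unfolding Q.span_def using fin carR by blast
  qed
  have li: "Q.lin_indpt (e ` I)"
  proof (rule Q.finite_lin_indpt2[OF finite_imageI[OF fin] eQ])
    fix a assume "Q.lincomb a (e ` I) = \<zero>\<^bsub>?Q\<^esub>"
    hence *: "(\<Sum>i\<in>I. sc (a (e i)) (w i)) \<in> B" using lc[of I a] by (simp add: zr cs_eq)
    hence "\<forall>j\<in>I. f (\<Sum>i\<in>I. sc (a (e i)) (w i)) j = 0" using ker sub by blast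
    thus "\<forall>v\<in>e ` I. a v = \<zero>\<^bsub>?R\<^esub>" by (simp add: fsum' zeroR)
  qed
  have span: "Q.span (e ` I) = carrier ?Q"
    using gen Q.span_is_subset2[OF eQ] by blast
  have "Q.basis (e ` I)" unfolding Q.basis_def using li span eQ by blast
  hence "Q.dim = card I" using Q.dim_basis[OF finite_imageI[OF fin]] card_image[OF inj] by simp
  moreover have "Q.fin_dim" unfolding Q.fin_dim_def using finite_imageI[OF fin] eQ span by blast
  ultimately show ?thesis by blast
qed



section \<open>The symplectic form and semilinear functions\<close>

lemma sum_heis_sum_index:
  "(\<Sum>j\<in>(UNIV :: ('m::finite + 'm) set). f j) =
     (\<Sum>i\<in>UNIV. f (Inl i)) + (\<Sum>i\<in>UNIV. f (Inr i))"
  by (simp add: UNIV_Plus_UNIV[symmetric] sum.Plus del: UNIV_Plus_UNIV)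

definition symp :: "('a::field, 'm::finite) heis \<Rightarrow> ('a, 'm) heis \<Rightarrow> 'a" where
  "symp x y = heis_bracket x y $ None"

lemma bracket_eq_symp: "heis_bracket x y = symp x y *s axis None 1"
  by (simp add: symp_def heis_bracket_def)

lemma symp_simps [simp]:
  "symp (x + y) v = symp x v + symp y v" "symp v (x + y) = symp v x + symp v y"
  "symp (a *s x) v = a * symp x v" "symp v (a *s x) = a * symp v x"
  "symp (- x) v = - symp x v" "symp v (- x) = - symp v x"
  "symp (x - y) v = symp x v - symp y v" "symp v (x - y) = symp v x - symp v y"
  "symp 0 v = 0" "symp v 0 = 0"
  "symp (axis None 1) v = 0" "symp v (axis None 1) = 0" "symp x x = 0"
proof -
  show "symp (axis None 1) v = 0" "symp v (axis None 1) = 0"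
    using heis_bracket_central(1)[of 1 v] heis_bracket_central(2)[of v 1] by (simp_all add: symp_def)
qed (simp_all add: symp_def heis_bracket_add heis_bracket_diff heis_bracket_minus heis_bracket_scale)

lemma symp_commute: "symp x y = - symp y x"
  unfolding symp_def by (subst heis_bracket_commute) simp

lemma symp_basis:
  "symp (axis (Some (Inl i)) 1) v = v $ Some (Inr i)"
  "symp (axis (Some (Inr i)) 1) v = - v $ Some (Inl i)"
  by (simp_all add: symp_def heis_bracket_def axis_def sum_negf
      if_distrib[of "\<lambda>c. c * _"] cong: if_cong)

text \<open>
  The vector of \<open>V\<close> that represents the linear form \<open>e\<^sub>j \<mapsto> b j\<close> through the symplectic form.
\<close>

definition sharp :: "('m + 'm \<Rightarrow> 'a) \<Rightarrow> ('a::field, 'm::finite) heis" where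
  "sharp b = (\<chi> k. case k of None \<Rightarrow> 0 | Some (Inl i) \<Rightarrow> - b (Inr i) | Some (Inr i) \<Rightarrow> b (Inl i))"

lemma sharp_None [simp]: "sharp b $ None = 0"
  by (simp add: sharp_def)

lemma symp_sharp: "symp g (sharp b) = (\<Sum>j\<in>UNIV. g $ Some j * b j)"
  by (simp add: symp_def heis_bracket_def sharp_def sum_heis_sum_index sum.distrib)

lemma symp_basis_sharp [simp]: "symp (axis (Some j) 1) (sharp b) = b j"
  by (cases j) (simp_all add: symp_basis sharp_def)

text \<open>
  The symplectic form is nondegenerate on \<open>V\<close>, so its values and the central component determine a
  vector. Identities between vectors are thereby reduced to scalar ones.
\<close>

lemma heis_eqI:
  assumes "\<And>j. symp (axis (Some j) 1) v = symp (axis (Some j) 1) w" and "v $ None = w $ None"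
  shows "v = w"
proof -
  have "v $ k = w $ k" for k
  proof (cases k)
    case (Some j)
    thus ?thesis using assms(1)[of "Inl (projr j)"] assms(1)[of "Inr (projl j)"]
      by (cases j) (simp_all add: symp_basis)
  qed (simp add: assms)
  thus ?thesis by (simp add: vec_eq_iff)
qed

text \<open>
  With \<open>\<tau> a = a\<close> these are the linear forms; with \<open>\<tau> a = a ^ p\<close> they are the components of the maps \<open>\<omega>\<close>
  that are compatible with \<open>\<phi> = 0\<close>. Both are determined by their values on the basis.
\<close>

definition semilinear :: "('a \<Rightarrow> 'a) \<Rightarrow> ('a::field ^ 'k::finite \<Rightarrow> 'a) \<Rightarrow> bool" where
  "semilinear \<tau> f \<longleftrightarrow> (\<forall>x y. f (x + y) = f x + f y) \<and> (\<forall>a x. f (a *s x) = \<tau> a * f x)"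

abbreviation linear_form :: "('a::field ^ 'k::finite \<Rightarrow> 'a) \<Rightarrow> bool" where
  "linear_form \<equiv> semilinear (\<lambda>a. a)"

lemma semilinear_expansion:
  assumes "semilinear \<tau> f"
  shows "f g = (\<Sum>k\<in>UNIV. \<tau> (g $ k) * f (axis k 1))"
proof -
  have add: "f (x + y) = f x + f y" and sc: "f (a *s x) = \<tau> a * f x" for x y a
    using assms by (auto simp: semilinear_def)
  have 0: "f 0 = 0" using sc[of 0 0] add[of 0 0] by (metis add_0_left add_right_cancel)
  have "f (\<Sum>k\<in>A. g $ k *s axis k 1) = (\<Sum>k\<in>A. \<tau> (g $ k) * f (axis k 1))" for A
    by (induction A rule: infinite_finite_induct) (simp_all add: 0 add sc)
  thus ?thesis using basis_expansion[of g] by (metis (no_types, lifting))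
qed

lemma semilinear_eq_0:
  assumes "semilinear \<tau> f" "\<And>k. f (axis k 1) = 0"
  shows "f g = 0"
  by (simp add: semilinear_expansion[OF assms(1), of g] assms(2))

lemma C2D:
  assumes "\<phi> \<in> C2"
  shows "\<phi> (x + y) v = \<phi> x v + \<phi> y v" "\<phi> v (x + y) = \<phi> v x + \<phi> v y"
    "\<phi> (a *s x) v = a *s \<phi> x v" "\<phi> v (a *s x) = a *s \<phi> v x"
    "\<phi> 0 v = 0" "\<phi> v 0 = 0" "\<phi> v v = 0" "\<phi> x v = - \<phi> v x"
proof -
  have *: "\<phi> (x + y) v = \<phi> x v + \<phi> y v" "\<phi> v (x + y) = \<phi> v x + \<phi> v y"
    "\<phi> (a *s x) v = a *s \<phi> x v" "\<phi> v (a *s x) = a *s \<phi> v x" "\<phi> v v = 0" for x y v a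
    using assms by (auto simp: C2_def linear_vec_iff)
  show "\<phi> (x + y) v = \<phi> x v + \<phi> y v" "\<phi> v (x + y) = \<phi> v x + \<phi> v y"
    "\<phi> (a *s x) v = a *s \<phi> x v" "\<phi> v (a *s x) = a *s \<phi> v x" "\<phi> v v = 0" by (fact *)+
  show "\<phi> 0 v = 0" "\<phi> v 0 = 0" using *(3)[of 0 0 v] *(4)[of v 0 0] by simp_all
  have "\<phi> (x + v) (x + v) = 0" by (rule *)
  hence "\<phi> x v + \<phi> v x = 0" using *(5)[of x] *(5)[of v] by (simp add: *(1,2) add.commute)
  thus "\<phi> x v = - \<phi> v x" by (simp add: eq_neg_iff_add_eq_0)
qed

lemma C2_eq_0:
  assumes "\<phi> \<in> C2" "\<And>a b. \<phi> (axis a 1) (axis b 1) = 0"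
  shows "\<phi> = 0"
proof -
  have l: "linear_form (\<lambda>g. \<phi> g h $ k)" "linear_form (\<lambda>h. \<phi> g h $ k)" for g h k
    by (simp_all add: semilinear_def C2D(1-4)[OF assms(1)])
  have 1: "\<phi> (axis a 1) h $ k = 0" for a h k
    using l(2) by (rule semilinear_eq_0) (simp add: assms(2))
  have "\<phi> g h $ k = 0" for g h k
    by (rule semilinear_eq_0[OF l(1) 1])
  thus ?thesis by (simp add: fun_eq_iff vec_eq_iff)
qed

lemma compatible_0_iff:
  fixes \<omega> :: "('a::field, 'm::finite) heis \<Rightarrow> ('a, 'm) heis"
  shows "compatible 0 \<omega> \<longleftrightarrow> (\<forall>k. semilinear (\<lambda>a. a ^ CHAR('a)) (\<lambda>g. \<omega> g $ k))"
  by (auto simp: compatible_def semilinear_def compat_term_zero vec_eq_iff)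

lemma compatible_0_eq_0:
  assumes "compatible 0 \<omega>" "\<And>k. \<omega> (axis k 1) = 0"
  shows "\<omega> = 0"
  using semilinear_eq_0[OF assms(1)[unfolded compatible_0_iff, rule_format]] assms(2)
  by (simp add: fun_eq_iff vec_eq_iff)

lemma pmap_basis:
  assumes "CHAR('a::field) > 0"
  shows "heis_pmap lam (axis k 1 :: ('a, 'm::finite) heis) = lam $ k *s axis None 1"
proof -
  have 1: "(\<Sum>l\<in>UNIV. (axis k 1 $ l :: 'a) ^ CHAR('a) * lam $ l) = lam $ k"
  proof -
    have "(\<Sum>l\<in>UNIV. (axis k 1 $ l :: 'a) ^ CHAR('a) * lam $ l) = (\<Sum>l\<in>UNIV. if l = k then lam $ l else 0)"
      by (intro sum.cong) (use assms in \<open>simp_all add: axis_def\<close>)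
    thus ?thesis by simp
  qed
  have 2: "(axis k 1 :: ('a, 'm) heis) $ Some (Inl j) * axis k 1 $ Some (Inr j) = 0" for j
    by (auto simp: axis_def)
  show ?thesis unfolding heis_pmap_def 1 2 by simp
qed

lemma semilinear_power_sum:
  assumes "CHAR('a::field) > 0"
  shows "semilinear (\<lambda>a. a ^ CHAR('a)) (\<lambda>g :: 'a ^ 'k::finite. \<Sum>k\<in>UNIV. (g $ k) ^ CHAR('a) * t k)"
proof -
  have 1: "((x + y) $ k) ^ CHAR('a) * t k = (x $ k) ^ CHAR('a) * t k + (y $ k) ^ CHAR('a) * t k"
    for x y :: "'a ^ 'k" and k
    by (simp only: vector_add_component freshmans_dream[OF prime_CHAR_semidom[OF assms] refl] distrib_right)
  have 2: "((a *s x) $ k) ^ CHAR('a) * t k = a ^ CHAR('a) * ((x $ k) ^ CHAR('a) * t k)"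
    for x :: "'a ^ 'k" and a k
    by (simp only: vector_smult_component power_mult_distrib mult.assoc)
  show ?thesis unfolding semilinear_def 1 2 sum.distrib sum_distrib_left by (intro conjI allI refl)
qed


section \<open>Counting coordinates\<close>

text \<open>
  An arbitrary total order on the index type, which singles out the independent entries of symmetric
  and alternating arrays.
\<close>

abbreviation rk :: "'k::finite \<Rightarrow> nat" where
  "rk \<equiv> to_nat_on UNIV"

lemma bij_rk: "bij_betw (rk :: 'k::finite \<Rightarrow> nat) UNIV {..<CARD('k)}"
  by (rule to_nat_on_finite) simp

lemma rk_eq_iff [simp]: "rk a = rk b \<longleftrightarrow> a = (b :: 'k::finite)"
  using bij_rk[where 'k='k] by (auto simp: bij_betw_def dest: injD)

lemma rk_lt_card: "rk (a :: 'k::finite) < CARD('k)"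
  using bij_rk[where 'k='k] by (auto simp: bij_betw_def)

lemma card_rk_less: "card {i :: 'k::finite. rk i < rk (j :: 'k)} = rk j"
  and card_rk_le: "card {i :: 'k::finite. rk i \<le> rk (j :: 'k)} = Suc (rk j)"
proof -
  have *: "card {i :: 'k. rk i \<in> A} = card A" if "A \<subseteq> {..<CARD('k)}" for A
  proof -
    have "A \<subseteq> range (rk :: 'k \<Rightarrow> nat)" using that bij_rk[where 'k='k] by (simp add: bij_betw_def)
    hence "rk ` {i :: 'k. rk i \<in> A} = A" by blast
    hence "bij_betw rk {i :: 'k. rk i \<in> A} A" by (simp add: bij_betw_def inj_on_def)
    thus ?thesis by (rule bij_betw_same_card)
  qed
  show "card {i :: 'k. rk i < rk j} = rk j" "card {i :: 'k. rk i \<le> rk j} = Suc (rk j)"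
    using *[of "{..<rk j}"] *[of "{..rk j}"] rk_lt_card[of j] by (auto simp: subset_eq)
qed

lemma sum_rk: "(\<Sum>j\<in>(UNIV :: 'k::finite set). f (rk j)) = (\<Sum>t<CARD('k). f t)"
  by (rule sum.reindex_bij_betw[OF bij_rk])

definition pairs_lt :: "('k::finite \<times> 'k) set" where
  "pairs_lt = (SIGMA j:UNIV. {i. rk i < rk j})"

definition pairs_le :: "('k::finite \<times> 'k) set" where
  "pairs_le = (SIGMA j:UNIV. {i. rk i \<le> rk j})"

text \<open>
  The array of a trilinear form \<open>\<Phi>(k; i, j)\<close> that is alternating in \<open>i, j\<close> and has cyclic sum \<open>0\<close> is
  given freely by its entries with \<open>i < j\<close> and \<open>k \<le> j\<close>: an entry with \<open>i < j < k\<close> is expressed through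
  \<open>(i; j, k)\<close> and \<open>(j; i, k)\<close>. The largest index \<open>j\<close> is stored first.
\<close>

definition triples :: "('k::finite \<times> 'k \<times> 'k) set" where
  "triples = (SIGMA j:UNIV. {i. rk i < rk j} \<times> {k. rk k \<le> rk j})"

lemma card_pairs_lt: "2 * card (pairs_lt :: ('k::finite \<times> 'k) set) + CARD('k) = CARD('k)\<^sup>2"
proof -
  have "2 * (\<Sum>t<n. t) + n = n\<^sup>2" for n :: nat
    by (induction n) (simp_all add: power2_eq_square)
  thus ?thesis by (simp add: pairs_lt_def card_SigmaI card_rk_less sum_rk[of "\<lambda>t. t"])
qed

lemma card_pairs_le: "2 * card (pairs_le :: ('k::finite \<times> 'k) set) = CARD('k)\<^sup>2 + CARD('k)"
proof -
  have "2 * (\<Sum>t<n. Suc t) = n\<^sup>2 + n" for n :: nat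
    by (induction n) (simp_all add: power2_eq_square)
  thus ?thesis by (simp add: pairs_le_def card_SigmaI card_rk_le sum_rk[of Suc])
qed

lemma card_triples: "3 * card (triples :: ('k::finite \<times> 'k \<times> 'k) set) + CARD('k) = CARD('k) ^ 3"
proof -
  have "3 * (\<Sum>t<n. t * Suc t) + n = n ^ 3" for n :: nat
    by (induction n) (simp_all add: power3_eq_cube algebra_simps)
  thus ?thesis
    by (simp add: triples_def card_SigmaI card_cartesian_product card_rk_less card_rk_le
        sum_rk[of "\<lambda>t. t * Suc t"] del: mult_Suc_right)
qed


section \<open>First cohomology\<close>

definition lin_ext :: "('k::finite \<Rightarrow> 'a::field ^ 'l::finite) \<Rightarrow> 'a ^ 'k \<Rightarrow> 'a ^ 'l" where
  "lin_ext u g = (\<Sum>k\<in>UNIV. g $ k *s u k)"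

lemma lin_ext_basis [simp]: "lin_ext u (axis k 1) = u k"
  by (simp add: lin_ext_def axis_def if_distrib[of "\<lambda>c. c *s _"] cong: if_cong)

lemma lin_ext_C1: "lin_ext u \<in> C1"
  by (simp add: C1_def linear_vec_iff lin_ext_def vec.scale_left_distrib sum.distrib
      vec.scale_sum_right)

lemma C1_eqI:
  assumes "\<psi> \<in> C1" "\<xi> \<in> C1" "\<And>k. \<psi> (axis k 1) = \<xi> (axis k 1)"
  shows "\<psi> = \<xi>"
proof -
  have "linear_form (\<lambda>g. (\<psi> g - \<xi> g) $ k)" for k
    by (simp add: semilinear_def C1D[OF assms(1)] C1D[OF assms(2)] algebra_simps)
  hence "(\<psi> g - \<xi> g) $ k = 0" for g k
    by (rule semilinear_eq_0) (simp add: assms(3))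
  thus ?thesis by (simp add: fun_eq_iff vec_eq_iff)
qed

text \<open>
  Iterated brackets of length three vanish, so the power of the adjoint map contributes only if its
  exponent \<open>p - 1\<close> is \<open>1\<close>.
\<close>

lemma ind1_eq:
  fixes lam :: "('a::field, 'm::finite) heis"
  assumes "CHAR('a) > 0"
  shows "ind1 lam \<psi> g = \<psi> (heis_pmap lam g) -
    (if CHAR('a) = 2 then symp g (\<psi> g) *s axis None 1 else 0)"
proof (cases "CHAR('a) = 2")
  case False
  hence "CHAR('a) - 1 \<ge> 2" using CHAR_ge2[OF assms] by simp
  thus ?thesis using False by (simp add: ind1_def heis_ad_ge2 del: One_nat_def)
qed (simp add: ind1_def bracket_eq_symp)

lemma d1_None: "d1 \<psi> g h $ None = symp g (\<psi> h) - symp h (\<psi> g) - \<psi> (heis_bracket g h) $ None"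
  by (simp add: d1_def symp_def)

lemma d1_symp: "symp k (d1 \<psi> g h) = - symp k (\<psi> (heis_bracket g h))"
  by (simp add: d1_def bracket_eq_symp)

text \<open>
  The value at \<open>z\<close> is central because \<open>z\<close> is the bracket of a hyperbolic pair; the second condition is
  the derivation rule on \<open>V\<close>. Once \<open>d1 \<psi> = 0\<close>, the map \<open>ind1 lam \<psi>\<close> is \<open>p\<close>-semilinear, so it suffices to
  test it on the basis, which gives the third condition. For \<open>p = 2\<close> and the index \<open>None\<close> the latter
  reads \<open>\<mu> \<lambda>\<^sub>2\<^sub>m\<^sub>+\<^sub>1 = 0\<close>.
\<close>

lemma ker_d1_res_iff:
  fixes lam :: "('a::field, 'm::finite) heis"
  assumes p: "CHAR('a) > 0" and psi: "\<psi> \<in> C1"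
  defines "\<mu> \<equiv> \<psi> (axis None 1) $ None"
  shows "d1_res lam \<psi> = 0 \<longleftrightarrow>
    \<psi> (axis None 1) = \<mu> *s axis None 1 \<and>
    (\<forall>a b. symp (axis (Some a) 1) (\<psi> (axis (Some b) 1)) - symp (axis (Some b) 1) (\<psi> (axis (Some a) 1))
        = \<mu> * symp (axis (Some a) 1) (axis (Some b) 1)) \<and>
    (\<forall>k. \<mu> * lam $ k = (if CHAR('a) = 2 then symp (axis k 1) (\<psi> (axis k 1)) else 0))"
    (is "_ \<longleftrightarrow> ?A \<and> ?B \<and> ?C")
proof
  assume "d1_res lam \<psi> = 0"
  hence d: "d1 \<psi> g h = 0" and i: "ind1 lam \<psi> g = 0" for g h
    by (auto simp: d1_res_def zero_prod_def fun_eq_iff)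
  have "symp k (\<psi> (axis None 1)) = 0" for k
  proof -
    fix i :: 'm
    let ?g = "axis (Some (Inl i)) 1 :: ('a, 'm) heis" and ?h = "axis (Some (Inr i)) 1 :: ('a, 'm) heis"
    have "heis_bracket ?g ?h = axis None 1" by (simp add: bracket_eq_symp symp_basis)
    thus ?thesis using d1_symp[of k \<psi> ?g ?h] d by simp
  qed
  hence A: ?A by (intro heis_eqI) (simp_all add: \<mu>_def)
  have ?B
  proof (intro allI)
    fix a b
    show "symp (axis (Some a) 1) (\<psi> (axis (Some b) 1)) - symp (axis (Some b) 1) (\<psi> (axis (Some a) 1))
        = \<mu> * symp (axis (Some a) 1) (axis (Some b) 1)"
      using d1_None[of \<psi> "axis (Some a) 1" "axis (Some b) 1"]
      by (simp add: d bracket_eq_symp C1D(2)[OF psi] A mult.commute)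
  qed
  moreover have ?C
  proof
    fix k
    have "ind1 lam \<psi> (axis k 1) $ None = 0" using i by simp
    thus "\<mu> * lam $ k = (if CHAR('a) = 2 then symp (axis k 1) (\<psi> (axis k 1)) else 0)"
      by (simp add: ind1_eq[OF p] pmap_basis[OF p] C1D(2)[OF psi] A mult.commute split: if_splits)
  qed
  ultimately show "?A \<and> ?B \<and> ?C" using A by blast
next
  assume *: "?A \<and> ?B \<and> ?C"
  hence A: ?A and B: ?B and C: ?C by blast+
  have "d1 \<psi> (axis a 1) (axis b 1) = 0" for a b
  proof (rule heis_eqI)
    show "d1 \<psi> (axis a 1) (axis b 1) $ None = 0 $ None"
      using B by (cases a; cases b)
        (simp_all add: d1_None bracket_eq_symp C1D(2,3)[OF psi] A mult.commute)
  qed (simp add: d1_symp bracket_eq_symp C1D(2)[OF psi] A)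
  hence d: "d1 \<psi> = 0" by (intro C2_eq_0 d1_in_C2 psi)
  have "d1_res lam \<psi> \<in> C2_res" using d1_res_subset_ker[OF p, of lam] psi by blast
  hence "compatible 0 (- ind1 lam \<psi>)" by (simp add: d1_res_def C2_res_def d)
  hence "- ind1 lam \<psi> = 0"
  proof (rule compatible_0_eq_0)
    fix k
    have "\<mu> * lam $ k = (if CHAR('a) = 2 then symp (axis k 1) (\<psi> (axis k 1)) else 0)" using C by blast
    thus "(- ind1 lam \<psi>) (axis k 1) = 0"
      by (simp add: ind1_eq[OF p] pmap_basis[OF p] C1D(2)[OF psi] A mult.commute vec.scale_left_commute
          split: if_splits)
  qed
  thus "d1_res lam \<psi> = 0" by (simp add: d1_res_def d zero_prod_def)
qed

text \<open>
  \<open>P\<close> lists the free entries of the matrix of \<open>S\<close>, where the diagonal is free only for \<open>p > 2\<close>, and \<open>M\<close>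
  records whether \<open>\<mu>\<close> is free. With \<open>S = 0\<close> and \<open>\<mu> = 0\<close> only a linear form \<open>V \<rightarrow> F z\<close> remains, and such a
  map is inner by nondegeneracy.
\<close>

lemma H1_dim:
  fixes lam :: "('a::field, 'm::finite) heis"
  assumes p: "CHAR('a) > 0"
    and P: "P = (if CHAR('a) = 2 then pairs_lt else pairs_le)"
    and M: "M = (if CHAR('a) = 2 \<and> lam $ None = 0 \<or> CHAR('a) \<noteq> 2 \<and> lam = 0 then {()} else {})"
  shows "fin_dim_over (H1_res lam) \<and>
    dim_over (H1_res lam) = card (P :: (('m + 'm) \<times> ('m + 'm)) set) + card M"
proof -
  define f :: "(('a, 'm) heis \<Rightarrow> ('a, 'm) heis) \<Rightarrow> (('m + 'm) \<times> ('m + 'm)) + unit \<Rightarrow> 'a"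
    where "f \<psi> = case_sum (\<lambda>(j, i). symp (axis (Some j) 1) (\<psi> (axis (Some i) 1)))
                           (\<lambda>_. \<psi> (axis None 1) $ None)" for \<psi>
  have "fin_dim_over (H1_res lam) \<and> dim_over (H1_res lam) = card (P <+> M)"
    unfolding H1_res_def
  proof (rule quotient_space_dim[where f = f])
    show "vector_space (scale1 :: 'a \<Rightarrow> (('a, 'm) heis \<Rightarrow> _) \<Rightarrow> _)" by (rule vector_space_scale1)
    show "module.subspace scale1 {\<psi> \<in> C1. d1_res lam \<psi> = 0}" by (rule subspace_Z1)
    show "module.subspace scale1 (range (d0 :: ('a, 'm) heis \<Rightarrow> _))" by (rule subspace_range_d0)
    show "range d0 \<subseteq> {\<psi> \<in> C1. d1_res lam \<psi> = 0}" by (rule range_d0_subset_ker[OF p])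
    show "finite (P <+> M)" by simp
    show "f (x + y) i = f x i + f y i" "f (scale1 a x) i = a * f x i" for x y i a
      by (auto simp: f_def scale1_def split: sum.splits)
  next
    fix \<psi> assume "\<psi> \<in> {\<psi> \<in> C1. d1_res lam \<psi> = 0}"
    hence C1: "\<psi> \<in> C1" and d: "d1_res lam \<psi> = 0" by auto
    define \<mu> where "\<mu> = \<psi> (axis None 1) $ None"
    note ker = d[unfolded ker_d1_res_iff[OF p C1], folded \<mu>_def]
    have A: "\<psi> (axis None 1) = \<mu> *s axis None 1"
      and B: "symp (axis (Some a) 1) (\<psi> (axis (Some b) 1)) - symp (axis (Some b) 1) (\<psi> (axis (Some a) 1))
        = \<mu> * symp (axis (Some a) 1) (axis (Some b) 1)"
      and C: "\<mu> * lam $ k = (if CHAR('a) = 2 then symp (axis k 1) (\<psi> (axis k 1)) else 0)" for a b k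
      using ker by blast+
    show "(\<forall>i\<in>P <+> M. f \<psi> i = 0) \<longleftrightarrow> \<psi> \<in> range d0"
    proof
      assume z: "\<forall>i\<in>P <+> M. f \<psi> i = 0"
      have \<mu>: "\<mu> = 0"
      proof (cases "M = {}")
        case False
        hence "Inr () \<in> P <+> M" by auto
        hence "f \<psi> (Inr ()) = 0" using z by blast
        thus ?thesis by (simp add: f_def \<mu>_def)
      next
        case True
        then obtain k where "lam $ k \<noteq> 0" "CHAR('a) = 2 \<longrightarrow> k = None"
          by (auto simp: M vec_eq_iff split: if_splits)
        thus ?thesis using C[of k] by (auto split: if_splits)
      qed
      have le: "symp (axis (Some j) 1) (\<psi> (axis (Some i) 1)) = 0" if "rk i \<le> rk j" for i j
      proof (cases "(j, i) \<in> P")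
        case True
        thus ?thesis using z[rule_format, of "Inl (j, i)"] by (auto simp: f_def)
      next
        case False
        hence "CHAR('a) = 2 \<and> i = j"
          using that by (auto simp: P pairs_lt_def pairs_le_def le_less split: if_splits)
        thus ?thesis using C[of "Some j"] \<mu> by simp
      qed
      have S: "symp (axis (Some j) 1) (\<psi> (axis (Some i) 1)) = 0" for i j
        using le[of i j] le[of j i] B[of i j] \<mu> by (cases "rk i \<le> rk j") simp_all
      define x where "x = (sharp (\<lambda>i. - \<psi> (axis (Some i) 1) $ None) :: ('a, 'm) heis)"
      have "\<psi> = d0 x"
      proof (rule C1_eqI[OF C1])
        show "d0 x \<in> C1" using range_d0_subset_ker[OF p, of lam] by blast
        fix k
        show "\<psi> (axis k 1) = d0 x (axis k 1)"
        proof (cases k)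
          case None
          thus ?thesis by (simp add: A \<mu> d0_def bracket_eq_symp)
        next
          case (Some i)
          have "symp x (axis (Some i) 1) = \<psi> (axis (Some i) 1) $ None"
            by (subst symp_commute) (simp add: x_def)
          thus ?thesis unfolding Some
            by (intro heis_eqI) (simp_all add: S d0_def bracket_eq_symp)
        qed
      qed
      thus "\<psi> \<in> range d0" by blast
    next
      assume "\<psi> \<in> range d0"
      thus "\<forall>i\<in>P <+> M. f \<psi> i = 0"
        by (auto simp: f_def d0_def bracket_eq_symp)
    qed
  next
    fix c :: "(('m + 'm) \<times> ('m + 'm)) + unit \<Rightarrow> 'a"
    define \<mu> where "\<mu> = (if M = {} then 0 else c (Inr ()))"
    have \<mu>: "\<mu> * lam $ k = 0" if "CHAR('a) = 2 \<longrightarrow> k = None" for k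
      using that by (auto simp: \<mu>_def M)
    \<comment> \<open>Half of the matrix is prescribed by \<open>c\<close>, the opposite half follows from the derivation rule,
      and the diagonal follows from the \<open>p\<close>-map condition if \<open>p = 2\<close>.\<close>
    define S where "S i j =
      (if rk i < rk j then c (Inl (j, i))
       else if i = j then if CHAR('a) = 2 then \<mu> * lam $ Some i else c (Inl (i, i))
       else c (Inl (i, j)) + \<mu> * symp (axis (Some j) 1) (axis (Some i) 1 :: ('a, 'm) heis))" for i j
    define \<psi> :: "('a, 'm) heis \<Rightarrow> ('a, 'm) heis" where
      "\<psi> = lin_ext (\<lambda>k. case k of None \<Rightarrow> \<mu> *s axis None 1 | Some i \<Rightarrow> sharp (S i))"
    have C1: "\<psi> \<in> C1" unfolding \<psi>_def by (rule lin_ext_C1)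
    have b: "\<psi> (axis None 1) = \<mu> *s axis None 1" "\<psi> (axis (Some i) 1) = sharp (S i)" for i
      by (simp_all add: \<psi>_def)
    have B: "S b a - S a b = \<mu> * symp (axis (Some a) 1) (axis (Some b) 1 :: ('a, 'm) heis)" for a b
    proof (cases "rk a < rk b" "rk b < rk a" rule: bool.exhaust[case_product bool.exhaust])
      case False_False
      hence "a = b" by simp
      thus ?thesis by simp
    next
      case False_True
      thus ?thesis
        using symp_commute[of "axis (Some a) 1" "axis (Some b) 1 :: ('a, 'm) heis"]
        by (auto simp: S_def)
    qed (auto simp: S_def)
    have "\<mu> * lam $ k = (if CHAR('a) = 2 then symp (axis k 1) (\<psi> (axis k 1)) else 0)" for k
      using \<mu>[of k] by (cases k) (simp_all add: b S_def)
    hence d: "d1_res lam \<psi> = 0"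
      unfolding ker_d1_res_iff[OF p C1] by (simp add: b B)
    have "f \<psi> i = c i" if "i \<in> P <+> M" for i
      using that by (auto simp: f_def b S_def P pairs_lt_def pairs_le_def \<mu>_def split: if_splits)
    thus "\<exists>z\<in>{\<psi> \<in> C1. d1_res lam \<psi> = 0}. \<forall>i\<in>P <+> M. f z i = c i"
      using C1 d by blast
  qed
  thus ?thesis by (simp add: card_Plus)
qed


section \<open>The hook form of a two-cocycle\<close>

text \<open>
  The complete invariant of ordinary cohomology classes. On cocycles it takes values in the kernel
  of \<open>V\<^sup>* \<otimes> \<Lambda>\<^sup>2 V\<^sup>* \<rightarrow> \<Lambda>\<^sup>3 V\<^sup>*\<close>, the space of tensors of hook shape \<open>(2, 1)\<close>. The first term corrects
  \<open>B(k, \<phi>(g, h))\<close> by the form \<open>b\<close> with \<open>\<phi>(z, k) = b(k) z\<close>, which coboundaries change arbitrarily.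
\<close>

definition hook_form :: "(('a::field, 'm::finite) heis \<Rightarrow> ('a, 'm) heis \<Rightarrow> ('a, 'm) heis) \<Rightarrow>
    ('a, 'm) heis \<Rightarrow> ('a, 'm) heis \<Rightarrow> ('a, 'm) heis \<Rightarrow> 'a" where
  "hook_form \<phi> k g h = symp g h * \<phi> (axis None 1) k $ None - symp k (\<phi> g h)"

lemma d2_symp:
  assumes "\<phi> \<in> C2"
  shows "symp w (d2 \<phi> g h k) = symp g k * symp w (\<phi> (axis None 1) h)
    - symp g h * symp w (\<phi> (axis None 1) k) - symp h k * symp w (\<phi> (axis None 1) g)"
  by (simp add: d2_def bracket_eq_symp C2D(3)[OF assms])

lemma d2_None:
  assumes "\<phi> \<in> C2"
  shows "d2 \<phi> g h k $ None = symp g (\<phi> h k) - symp h (\<phi> g k) + symp k (\<phi> g h)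
    - symp g h * \<phi> (axis None 1) k $ None + symp g k * \<phi> (axis None 1) h $ None
    - symp h k * \<phi> (axis None 1) g $ None"
  by (simp add: d2_def bracket_eq_symp C2D(3)[OF assms])

text \<open>
  The component of \<open>\<phi>(z, k)\<close> in \<open>V\<close> vanishes. Pairing the cocycle identity at \<open>g, h, k\<close> with \<open>w\<close> leaves
  only \<open>B(g, h) B(w, \<phi>(z, k))\<close> when \<open>g, h\<close> is a hyperbolic pair orthogonal to \<open>k\<close>; such a pair exists
  because \<open>m > 1\<close>.
\<close>

lemma cocycle_center:
  fixes \<phi> :: "('a::field, 'm::finite) heis \<Rightarrow> ('a, 'm) heis \<Rightarrow> ('a, 'm) heis"
  assumes m: "CARD('m) > 1" and phi: "\<phi> \<in> C2" and d: "d2 \<phi> = 0"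
  shows "symp w (\<phi> (axis None 1) k) = 0"
proof (rule semilinear_eq_0[where f = "\<lambda>k. symp w (\<phi> (axis None 1) k)"])
  show "linear_form (\<lambda>k. symp w (\<phi> (axis None 1) k))"
    by (simp add: semilinear_def C2D(2,4)[OF phi])
  fix k :: "('m + 'm) option"
  show "symp w (\<phi> (axis None 1) (axis k 1)) = 0"
  proof (cases k)
    case None
    thus ?thesis by (simp add: C2D(7)[OF phi])
  next
    case (Some j)
    obtain i :: 'm where i: "j \<noteq> Inl i" "j \<noteq> Inr i"
    proof -
      define i0 where "i0 = (case j of Inl i \<Rightarrow> i | Inr i \<Rightarrow> i)"
      have "UNIV \<noteq> {i0}" using m by (metis card_1_singleton_iff less_irrefl One_nat_def)
      then obtain i where "i \<noteq> i0" by blast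
      thus ?thesis using that[of i] by (cases j) (auto simp: i0_def)
    qed
    let ?g = "axis (Some (Inl i)) 1 :: ('a, 'm) heis" and ?h = "axis (Some (Inr i)) 1 :: ('a, 'm) heis"
    have "symp ?g ?h = 1" "symp ?g (axis k 1) = 0" "symp ?h (axis k 1) = 0"
      unfolding Some symp_basis using i by (simp_all add: axis_def)
    thus ?thesis using d2_symp[OF phi, of w ?g ?h "axis k 1"] d by (simp add: fun_eq_iff)
  qed
qed

text \<open>
  The central component of the cocycle identity.
\<close>

lemma hook_form_cyclic:
  assumes phi: "\<phi> \<in> C2" and d: "d2 \<phi> = 0"
  shows "hook_form \<phi> k g h + hook_form \<phi> g h k + hook_form \<phi> h k g = 0"
proof -
  have "symp h (\<phi> k g) = - symp h (\<phi> g k)" "symp k g = - symp g k"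
    using C2D(8)[OF phi, of k g] symp_commute[of k g] by simp_all
  thus ?thesis using d2_None[OF phi, of g h k] d by (simp add: hook_form_def algebra_simps)
qed

lemma hook_form_alternating:
  assumes phi: "\<phi> \<in> C2"
  shows "hook_form \<phi> k g g = 0" "hook_form \<phi> k h g = - hook_form \<phi> k g h"
  using C2D(8)[OF phi, of h g] symp_commute[of h g]
  by (simp_all add: hook_form_def C2D(7)[OF phi])

lemma hook_form_eq_0I:
  fixes \<phi> :: "('a::field, 'm::finite) heis \<Rightarrow> ('a, 'm) heis \<Rightarrow> ('a, 'm) heis"
  assumes m: "CARD('m) > 1" and phi: "\<phi> \<in> C2" and d: "d2 \<phi> = 0"
    and z: "\<And>j i k. (j, i, k) \<in> triples \<Longrightarrow>
      hook_form \<phi> (axis (Some k) 1) (axis (Some i) 1) (axis (Some j) 1) = 0"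
  shows "hook_form \<phi> k g h = 0"
proof -
  note cyc = hook_form_cyclic[OF phi d] and alt = hook_form_alternating[OF phi]
  let ?P = "\<lambda>a b c. hook_form \<phi> (axis (Some a) 1) (axis (Some b) 1) (axis (Some c) 1)"
  have lt: "?P k i j = 0" if "rk i < rk j" for k i j
  proof (cases "rk k \<le> rk j")
    case True
    thus ?thesis using that z by (simp add: triples_def)
  next
    case False
    \<comment> \<open>Here \<open>k\<close> is the largest index, and the cyclic relation reduces to the previous case.\<close>
    hence "?P i j k = 0" "?P j i k = 0" using that by (auto intro!: z simp: triples_def)
    thus ?thesis using cyc[of "axis (Some k) 1" "axis (Some i) 1" "axis (Some j) 1"]
      alt(2)[of "axis (Some j) 1" "axis (Some k) 1" "axis (Some i) 1"] by simp
  qed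
  have S: "?P k i j = 0" for k i j
  proof (cases "rk i" "rk j" rule: linorder_cases)
    case greater
    thus ?thesis using lt[of j i k] alt(2)[of "axis (Some k) 1" "axis (Some i) 1"] by simp
  qed (simp_all add: lt alt(1))
  have c: "hook_form \<phi> (axis None 1) g h = 0" "hook_form \<phi> k (axis None 1) h = 0" "hook_form \<phi> k h (axis None 1) = 0" for k g h
  proof -
    show "hook_form \<phi> (axis None 1) g h = 0" by (simp add: hook_form_def C2D(7)[OF phi])
    show 1: "hook_form \<phi> k (axis None 1) h = 0" for h
      by (simp add: hook_form_def cocycle_center[OF m phi d])
    show "hook_form \<phi> k h (axis None 1) = 0" using alt(2)[of k "axis None 1" h] 1[of h] by simp
  qed
  have basis: "hook_form \<phi> (axis a 1) (axis b 1) (axis c 1) = 0" for a b c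
    by (cases a; cases b; cases c) (simp_all add: c S)
  have l: "linear_form (\<lambda>k. hook_form \<phi> k g h)" "linear_form (\<lambda>g. hook_form \<phi> k g h)" "linear_form (\<lambda>h. hook_form \<phi> k g h)"
    for k g h
    by (simp_all add: semilinear_def hook_form_def C2D(1-4)[OF phi] algebra_simps)
  have 1: "hook_form \<phi> (axis a 1) (axis b 1) h = 0" for a b h
    by (rule semilinear_eq_0[OF l(3) basis])
  have 2: "hook_form \<phi> (axis a 1) g h = 0" for a g h
    by (rule semilinear_eq_0[OF l(2) 1])
  show ?thesis by (rule semilinear_eq_0[OF l(1) 2])
qed

lemma hook_form_d1:
  assumes "\<psi> \<in> C1"
  shows "hook_form (d1 \<psi>) k g h = 0"
  by (simp add: hook_form_def d1_None d1_symp bracket_eq_symp C1D(2,3)[OF assms])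

text \<open>
  The preimage \<open>\<psi>\<close> is built on the basis. Its value at \<open>z\<close> is forced up to the multiple \<open>\<mu>\<close> of \<open>z\<close> by
  \<open>\<phi>(z, -)\<close>, and since the hook form vanishes, this already matches the components of \<open>\<phi>\<close> in \<open>V\<close>. The
  central component of \<open>\<phi>\<close> on \<open>V\<close> only restricts the alternating part of the matrix \<open>S\<close>. For \<open>p = 2\<close> its
  diagonal is then used to match \<open>\<omega>\<close> on the basis vectors of \<open>V\<close>, which is why the hypothesis
  about \<open>\<omega>\<close> concerns only \<open>z\<close> in that case.
\<close>

lemma cocycle_is_coboundary:
  fixes lam :: "('a::field, 'm::finite) heis"
  assumes p: "CHAR('a) > 0"
    and c: "(\<phi>, \<omega>) \<in> C2_res" and d: "d2_res lam (\<phi>, \<omega>) = 0"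
    and hook_form: "\<And>k g h. hook_form \<phi> k g h = 0"
    and \<mu>: "\<And>k. (CHAR('a) = 2 \<Longrightarrow> k = None) \<Longrightarrow> \<omega> (axis k 1) $ None = - \<mu> * lam $ k"
  shows "(\<phi>, \<omega>) \<in> d1_res lam ` C1"
proof -
  have phi: "\<phi> \<in> C2" using c by (simp add: C2_res_def)
  let ?e = "\<lambda>i. axis (Some i) 1 :: ('a, 'm) heis" and ?z = "axis None 1 :: ('a, 'm) heis"
  define N where "N a b = \<phi> (?e a) (?e b) $ None + \<mu> * symp (?e a) (?e b)" for a b
  define S where "S i j = (if rk j < rk i then N j i else
    if i = j \<and> CHAR('a) = 2 then \<omega> (?e i) $ None + \<mu> * lam $ Some i else 0)" for i j
  define \<psi> :: "('a, 'm) heis \<Rightarrow> ('a, 'm) heis" where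
    "\<psi> = lin_ext (\<lambda>k. case k of None \<Rightarrow> sharp (\<lambda>j. - \<phi> ?z (?e j) $ None) + \<mu> *s ?z
                             | Some i \<Rightarrow> sharp (S i))"
  have C1: "\<psi> \<in> C1" unfolding \<psi>_def by (rule lin_ext_C1)
  have b: "\<psi> ?z = sharp (\<lambda>j. - \<phi> ?z (?e j) $ None) + \<mu> *s ?z" "\<psi> (?e i) = sharp (S i)" for i
    by (simp_all add: \<psi>_def)
  have S: "S b a - S a b = N a b" for a b
  proof (cases "rk a" "rk b" rule: linorder_cases)
    case less
    hence "a \<noteq> b" by auto
    thus ?thesis using less by (simp add: S_def)
  next
    case greater
    hence "a \<noteq> b" by auto
    thus ?thesis using greater C2D(8)[OF phi, of "?e a" "?e b"] symp_commute[of "?e a" "?e b"]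
      by (simp add: S_def N_def)
  qed (simp_all add: S_def N_def C2D(7)[OF phi])
  have "\<phi> (axis a 1) (axis b 1) = d1 \<psi> (axis a 1) (axis b 1)" for a b
  proof (rule heis_eqI)
    fix j
    show "symp (?e j) (\<phi> (axis a 1) (axis b 1)) = symp (?e j) (d1 \<psi> (axis a 1) (axis b 1))"
      using hook_form[of "?e j" "axis a 1" "axis b 1"]
      by (simp add: hook_form_def d1_symp bracket_eq_symp C1D(2)[OF C1] b)
  next
    show "\<phi> (axis a 1) (axis b 1) $ None = d1 \<psi> (axis a 1) (axis b 1) $ None"
    proof (cases a; cases b)
      fix i j assume "a = Some i" "b = Some j"
      thus ?thesis using S[of j i]
        by (simp add: d1_None bracket_eq_symp C1D(2)[OF C1] b N_def mult.commute)
    next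
      fix i assume "a = Some i" "b = None"
      thus ?thesis using C2D(8)[OF phi, of "?e i" ?z]
        by (simp add: d1_None bracket_eq_symp C1D(3)[OF C1] b)
    qed (simp_all add: d1_None bracket_eq_symp C1D(3)[OF C1] b C2D(7)[OF phi])
  qed
  moreover have "\<phi> - d1 \<psi> \<in> C2"
    using phi d1_in_C2[OF C1] by (simp add: C2_def linear_vec_iff vec.scale_right_diff_distrib)
  ultimately have "\<phi> - d1 \<psi> = 0" by (intro C2_eq_0) simp_all
  hence phi_eq: "\<phi> = d1 \<psi>" by simp
  \<comment> \<open>Now \<open>(0, \<omega>')\<close> is a cocycle. So \<open>\<omega>'\<close> is semilinear and its values are central; it remains to
    compare central components on the basis.\<close>
  define \<omega>' where "\<omega>' = \<omega> + ind1 lam \<psi>"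
  interpret v2: vector_space scale2_res by (rule vector_space_scale2_res)
  have "(\<phi>, \<omega>) - d1_res lam \<psi> \<in> {c \<in> C2_res. d2_res lam c = 0}"
    using c d d1_res_subset_ker[OF p, of lam] C1 by (intro v2.subspace_diff[OF subspace_Z2]) auto
  moreover have "(\<phi>, \<omega>) - d1_res lam \<psi> = (0, \<omega>')"
    by (simp add: d1_res_def phi_eq \<omega>'_def)
  ultimately have comp: "compatible 0 \<omega>'" and "ind2 lam 0 \<omega>' = 0"
    by (auto simp: C2_res_def d2_res_def zero_prod_def)
  hence "heis_bracket g (\<omega>' h) = 0" for g h
    by (simp add: fun_eq_iff ind2_def)
  hence V: "symp g (\<omega>' h) = 0" for g h by (simp add: symp_def)
  have "\<omega>' (axis k 1) = 0" for k
  proof (rule heis_eqI)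
    show "\<omega>' (axis k 1) $ None = 0 $ None"
    proof (cases "CHAR('a) = 2 \<longrightarrow> k = None")
      case True
      thus ?thesis using \<mu>[of k]
        by (auto simp: \<omega>'_def ind1_eq[OF p] pmap_basis[OF p] C1D(2)[OF C1] b mult.commute)
    next
      case False
      then obtain i where "k = Some i" "CHAR('a) = 2" by auto
      thus ?thesis
        by (simp add: \<omega>'_def ind1_eq[OF p] pmap_basis[OF p] C1D(2)[OF C1] b mult.commute S_def)
    qed
  qed (simp add: V)
  hence "\<omega>' = 0" by (rule compatible_0_eq_0[OF comp])
  hence "(\<phi>, \<omega>) = d1_res lam \<psi>"
    by (simp add: d1_res_def phi_eq \<omega>'_def eq_neg_iff_add_eq_0)
  thus ?thesis using C1 by blast
qed


section \<open>Cocycles with a given hook form\<close>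

definition tri :: "('m + 'm \<Rightarrow> 'm + 'm \<Rightarrow> 'm + 'm \<Rightarrow> 'a) \<Rightarrow> ('a::field, 'm::finite) heis \<Rightarrow>
    ('a, 'm) heis \<Rightarrow> ('a, 'm) heis \<Rightarrow> 'a" where
  "tri F x y w = (\<Sum>a\<in>UNIV. x $ Some a * (\<Sum>b\<in>UNIV. y $ Some b * (\<Sum>c\<in>UNIV. w $ Some c * F a b c)))"

lemma tri_linear:
  "tri F (x + x') y w = tri F x y w + tri F x' y w"
  "tri F x (y + y') w = tri F x y w + tri F x y' w"
  "tri F x y (w + w') = tri F x y w + tri F x y w'"
  "tri F (s *s x) y w = s * tri F x y w"
  "tri F x (s *s y) w = s * tri F x y w"
  "tri F x y (s *s w) = s * tri F x y w"
  by (simp_all add: tri_def algebra_simps sum.distrib sum_distrib_left)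

lemma tri_center [simp]:
  "tri F (axis None 1) y w = 0" "tri F x (axis None 1) w = 0" "tri F x y (axis None 1) = 0"
  by (simp_all add: tri_def axis_def)

lemma tri_basis_left: "tri F (axis (Some a) 1) y w =
    (\<Sum>b\<in>UNIV. y $ Some b * (\<Sum>c\<in>UNIV. w $ Some c * F a b c))"
  by (simp add: tri_def axis_def if_distrib[of "\<lambda>c. c * _"] cong: if_cong)

lemma tri_basis [simp]: "tri F (axis (Some a) 1) (axis (Some b) 1) (axis (Some c) 1) = F a b c"
  unfolding tri_basis_left by (simp add: axis_def if_distrib[of "\<lambda>c. c * _"] cong: if_cong)

lemma tri_sym:
  assumes "\<And>a b c. F a b c = F b a c"
  shows "tri F x y w = tri F y x w"
proof -
  have "tri F x y w = (\<Sum>a\<in>UNIV. \<Sum>b\<in>UNIV. x $ Some a * (y $ Some b * (\<Sum>c\<in>UNIV. w $ Some c * F a b c)))"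
    by (simp add: tri_def sum_distrib_left)
  also have "\<dots> = (\<Sum>b\<in>UNIV. \<Sum>a\<in>UNIV. x $ Some a * (y $ Some b * (\<Sum>c\<in>UNIV. w $ Some c * F a b c)))"
    by (rule sum.swap)
  also have "\<dots> = (\<Sum>b\<in>UNIV. y $ Some b * (\<Sum>a\<in>UNIV. x $ Some a * (\<Sum>c\<in>UNIV. w $ Some c * F b a c)))"
    by (simp add: sum_distrib_left assms mult.left_commute)
  finally show ?thesis by (simp add: tri_def)
qed

text \<open>
  The cochain with \<open>B(k, \<phi>(g, h)) = F(k, h, g) - F(k, g, h)\<close> and values in \<open>V\<close>. For \<open>F\<close> symmetric in its
  first two arguments, its hook form \<open>F(k, g, h) - F(k, h, g)\<close> is the image of \<open>F\<close> under the Koszul map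
  \<open>S\<^sup>2 V\<^sup>* \<otimes> V\<^sup>* \<rightarrow> V\<^sup>* \<otimes> \<Lambda>\<^sup>2 V\<^sup>*\<close>, so that the cyclic sum is \<open>0\<close>.
\<close>

definition koszul :: "('m + 'm \<Rightarrow> 'm + 'm \<Rightarrow> 'm + 'm \<Rightarrow> 'a) \<Rightarrow> ('a::field, 'm::finite) heis \<Rightarrow>
    ('a, 'm) heis \<Rightarrow> ('a, 'm) heis" where
  "koszul F g h = sharp (\<lambda>a. tri F (axis (Some a) 1) h g - tri F (axis (Some a) 1) g h)"

lemma symp_koszul: "symp k (koszul F g h) = tri F k h g - tri F k g h"
  unfolding koszul_def symp_sharp right_diff_distrib sum_subtractf tri_basis_left
  by (simp add: tri_def)

lemma koszul_None [simp]: "koszul F g h $ None = 0"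
  by (simp add: koszul_def)

lemma koszul_C2: "koszul F \<in> C2"
  by (auto simp: C2_def linear_vec_iff tri_linear symp_koszul algebra_simps intro!: heis_eqI)

lemma koszul_center [simp]:
  "koszul F (axis None 1) h = 0" "koszul F h (axis None 1) = 0"
  by (auto intro!: heis_eqI simp: symp_koszul)

lemma hook_form_koszul: "hook_form (koszul F) k g h = tri F k g h - tri F k h g"
  by (simp add: hook_form_def symp_koszul)

lemma koszul_cocycle:
  assumes "\<And>a b c. F a b c = F b a c"
  shows "d2 (koszul F) = 0"
proof -
  note s = tri_sym[of F, OF assms]
  have "d2 (koszul F) g h k $ None = 0" for g h k
    by (simp add: d2_None[OF koszul_C2] symp_koszul s[of h g] s[of k g] s[of k h])
  moreover have "symp w (d2 (koszul F) g h k) = 0" for w g h k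
    by (simp add: d2_symp[OF koszul_C2])
  ultimately show ?thesis by (intro ext heis_eqI) simp_all
qed

text \<open>
  For an unordered pair \<open>{x, y}\<close> with maximum \<open>j\<close> and minimum \<open>k\<close>, take \<open>F({x, y}, i) = - c (j, i, k)\<close> if
  \<open>i < j\<close>, and \<open>0\<close> otherwise. For \<open>i < j\<close> and \<open>k \<le> j\<close> the term \<open>F({k, i}, j)\<close> then vanishes, and
  \<open>- F({k, j}, i)\<close> is the prescribed value.
\<close>

lemma koszul_prescribed:
  fixes c :: "('m::finite + 'm) \<times> ('m + 'm) \<times> ('m + 'm) \<Rightarrow> 'a::field"
  shows "\<exists>F. (\<forall>x y w. F x y w = F y x w) \<and>
    (\<forall>j i k. (j, i, k) \<in> triples \<longrightarrow> F k i j - F k j i = c (j, i, k))"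
proof -
  define F where "F x y w = (if rk x \<le> rk y then (if rk w < rk y then - c (y, w, x) else 0)
    else (if rk w < rk x then - c (x, w, y) else 0))" for x y w
  show ?thesis
  proof (intro exI conjI allI impI)
    show "F x y w = F y x w" for x y w
      by (cases "rk x" "rk y" rule: linorder_cases) (simp_all add: F_def)
    show "F k i j - F k j i = c (j, i, k)" if "(j, i, k) \<in> triples" for j i k
      using that by (auto simp: triples_def F_def)
  qed
qed


section \<open>Lifting cocycles to restricted cocycles\<close>

text \<open>
  The compatibility condition involves brackets of \<open>p - 1\<close> and \<open>p - 2\<close> elements, and brackets of three
  or more elements vanish. So only \<open>p = 2\<close> and \<open>p = 3\<close> behave differently.
\<close>

lemma CHAR_cases:
  assumes "CHAR('a::field) > 0"
  obtains "CHAR('a) = 2" | "CHAR('a) = 3" | "CHAR('a) \<ge> 5"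
proof -
  have prime: "prime CHAR('a)" by (rule prime_CHAR_semidom[OF assms])
  have "CHAR('a) \<noteq> 4"
  proof
    assume "CHAR('a) = 4"
    hence "\<forall>n. n dvd (4 :: nat) \<longrightarrow> n = 1 \<or> n = 4" using prime by (simp only: prime_nat_iff) blast
    hence "(2 :: nat) dvd 4 \<longrightarrow> 2 = (1 :: nat) \<or> 2 = (4 :: nat)" by (rule spec)
    thus False by simp
  qed
  moreover have "CHAR('a) \<ge> 2" by (rule CHAR_ge2[OF assms])
  ultimately have "CHAR('a) = 2 \<or> CHAR('a) = 3 \<or> CHAR('a) \<ge> 5" by linarith
  thus ?thesis using that by blast
qed

lemma compatible_char2:
  fixes \<phi> :: "('a::field, 'm::finite) heis \<Rightarrow> ('a, 'm) heis \<Rightarrow> ('a, 'm) heis"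
  assumes "CHAR('a) = 2"
  shows "compatible \<phi> \<omega> \<longleftrightarrow> (\<forall>a g. \<omega> (a *s g) = a\<^sup>2 *s \<omega> g) \<and>
    (\<forall>g h. \<omega> (g + h) = \<omega> g + \<omega> h + \<phi> g h)"
proof -
  have "{s. length s = 2 \<and> s ! 0 = True \<and> s ! 1 = False} = {[True, False]}"
    by (auto simp: length_Suc_conv eval_nat_numeral)
  note set = this
  show ?thesis unfolding compatible_def assms set by (simp add: compat_term_def assms)
qed

lemma compatible_char3:
  fixes \<phi> :: "('a::field, 'm::finite) heis \<Rightarrow> ('a, 'm) heis \<Rightarrow> ('a, 'm) heis"
  assumes "CHAR('a) = 3"
  shows "compatible \<phi> \<omega> \<longleftrightarrow> (\<forall>a g. \<omega> (a *s g) = a ^ 3 *s \<omega> g) \<and>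
    (\<forall>g h. \<omega> (g + h) = \<omega> g + \<omega> h + inverse 2 *s (\<phi> (heis_bracket g h) g - heis_bracket g (\<phi> g h))
       + (\<phi> (heis_bracket g h) h - heis_bracket h (\<phi> g h)))"
proof -
  have "{s. length s = 3 \<and> s ! 0 = True \<and> s ! 1 = False} = {[True, False, True], [True, False, False]}"
    by (auto simp: length_Suc_conv eval_nat_numeral)
  note set = this
  show ?thesis unfolding compatible_def assms set by (simp add: compat_term_def assms add.assoc)
qed

lemma compatible_char_ge5:
  fixes \<phi> :: "('a::field, 'm::finite) heis \<Rightarrow> ('a, 'm) heis \<Rightarrow> ('a, 'm) heis"
  assumes p: "CHAR('a) \<ge> 5" and phi: "\<phi> \<in> C2"
  shows "compatible \<phi> \<omega> \<longleftrightarrow> compatible 0 \<omega>"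
proof -
  have "compat_term \<phi> xs = 0" if "length xs = CHAR('a)" for xs
  proof -
    have "left_normed (take (CHAR('a) - 1) xs) = 0" "left_normed (take (CHAR('a) - 2) xs) = 0"
      using p that by (auto intro!: left_normed_ge3)
    thus ?thesis by (simp add: compat_term_def Let_def C2D(5)[OF phi])
  qed
  hence "(\<Sum>s\<in>{s. length s = CHAR('a) \<and> s ! 0 = True \<and> s ! 1 = False}.
           inverse (of_nat (count_list s True)) *s
             compat_term \<phi> (map (\<lambda>b. if b then g else h) s)) = 0" for g h
    by (intro sum.neutral) simp
  thus ?thesis by (simp add: compatible_def compat_term_zero)
qed

text \<open>
  Every term either has a bracket or a value of the \<open>p\<close>-map, hence a multiple of \<open>z\<close>, as an argument of
  \<open>koszul F\<close>, or is a bracket with a central value of \<open>\<omega>\<close>.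
\<close>

lemma ind2_koszul_central:
  fixes lam :: "('a::field, 'm::finite) heis"
  assumes p: "CHAR('a) > 2" and V: "\<And>g h. symp g (\<omega> h) = 0"
  shows "ind2 lam (koszul F) \<omega> = 0"
proof -
  have c: "koszul F x (heis_pmap lam h) = 0" "koszul F x (heis_bracket g h) = 0" for x g h
    by (simp_all add: heis_pmap_def bracket_eq_symp C2D(4)[OF koszul_C2])
  have ad: "(heis_bracket h ^^ Suc n) g = heis_bracket h ((heis_bracket h ^^ n) g)" for h g :: "('a, 'm) heis" and n
    by simp
  define n where "n = CHAR('a) - 3"
  have "CHAR('a) - 1 = Suc (Suc n)" "CHAR('a) - 2 = Suc n" using p by (simp_all add: n_def)
  note e = this
  show ?thesis
  proof (intro ext)
    fix g h
    show "ind2 lam (koszul F) \<omega> g h = 0 g h"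
      unfolding ind2_def e ad c by (simp add: bracket_eq_symp V)
  qed
qed

text \<open>
  Compatibility prescribes the polarization of \<open>\<omega>\<close>. A first term of \<open>\<omega>\<close> takes care of it, and adding
  a central semilinear term \<open>f\<close> then gives arbitrary central values on the basis.
\<close>

lemma koszul_restricted:
  fixes lam :: "('a::field, 'm::finite) heis"
  assumes p: "CHAR('a) > 0" and F: "\<And>a b c. F a b c = F b a c"
  shows "\<exists>\<omega>. compatible (koszul F) \<omega> \<and> ind2 lam (koszul F) \<omega> = 0 \<and>
    (\<forall>k. \<omega> (axis k 1) $ None = t k)"
proof -
  note s = tri_sym[of F, OF F]
  define f where "f t' g = (\<Sum>k\<in>UNIV. (g $ k) ^ CHAR('a) * t' k)" for t' and g :: "('a, 'm) heis"
  have f_add: "f t' (g + h) = f t' g + f t' h" and f_sc: "f t' (a *s g) = a ^ CHAR('a) * f t' g" for t' g h a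
    using semilinear_power_sum[OF p, of t'] by (simp_all add: semilinear_def f_def)
  have f_basis: "f t' (axis k 1) = t' k" for t' k
  proof -
    have "f t' (axis k 1) = (\<Sum>l\<in>UNIV. if l = k then t' l else 0)"
      unfolding f_def by (intro sum.cong) (use p in \<open>simp_all add: axis_def\<close>)
    thus ?thesis by simp
  qed
  from p show ?thesis
  proof (cases rule: CHAR_cases)
    case 1
    \<comment> \<open>The component in \<open>V\<close> is forced by \<open>ind2 = 0\<close>, which reads \<open>B(g, \<omega>(h)) + B(h, \<phi>(h, g)) = 0\<close>. It is
      quadratic, and the cyclic relation shows that its polarization is \<open>\<phi>\<close>.\<close>
    define \<omega> where "\<omega> g = sharp (\<lambda>a. tri F g g (axis (Some a) 1) - tri F g (axis (Some a) 1) g)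
      + f t g *s axis None 1" for g
    have So: "symp (axis (Some a) 1) (\<omega> g) = tri F g g (axis (Some a) 1) - tri F g (axis (Some a) 1) g" for a g
      by (simp add: \<omega>_def)
    have No: "\<omega> g $ None = f t g" for g by (simp add: \<omega>_def)
    show ?thesis
    proof (intro exI conjI allI)
      show "compatible (koszul F) \<omega>" unfolding compatible_char2[OF 1]
      proof (intro conjI allI)
        fix a g show "\<omega> (a *s g) = a\<^sup>2 *s \<omega> g"
          by (rule heis_eqI) (simp_all add: So No f_sc 1 tri_linear power2_eq_square algebra_simps)
      next
        fix g h show "\<omega> (g + h) = \<omega> g + \<omega> h + koszul F g h"
        proof (rule heis_eqI)
          fix a
          let ?k = "axis (Some a) 1 :: ('a, 'm) heis"
          have e: "tri F h g ?k = - tri F g h ?k" and x: "tri F h ?k g + tri F h ?k g = 0"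
            using CHAR2(1)[OF 1] CHAR2(2)[OF 1, of "tri F h ?k g" "tri F h ?k g"] s[of h g] by simp_all
          have "symp ?k (\<omega> (g + h)) = symp ?k (\<omega> g + \<omega> h + koszul F g h)
              - (tri F h ?k g + tri F h ?k g)"
            unfolding symp_simps So symp_koszul tri_linear s[of ?k g] s[of ?k h] e
            by (simp only: algebra_simps) simp
          thus "symp ?k (\<omega> (g + h)) = symp ?k (\<omega> g + \<omega> h + koszul F g h)"
            unfolding x by simp
        qed (simp add: No f_add)
      qed
      show "ind2 lam (koszul F) \<omega> = 0"
      proof (intro ext)
        fix g h
        have "koszul F x (heis_pmap lam h) = 0" "koszul F x (heis_bracket g h) = 0" for x g h
          by (simp_all add: heis_pmap_def bracket_eq_symp C2D(4)[OF koszul_C2])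
        moreover have "symp g (\<omega> h) - (tri F h h g - tri F h g h) = 0"
        proof (rule semilinear_eq_0[where f = "\<lambda>g. symp g (\<omega> h) - (tri F h h g - tri F h g h)"])
          show "linear_form (\<lambda>g. symp g (\<omega> h) - (tri F h h g - tri F h g h))"
            by (simp add: semilinear_def tri_linear algebra_simps)
          show "symp (axis k 1) (\<omega> h) - (tri F h h (axis k 1) - tri F h (axis k 1) h) = 0" for k
            by (cases k) (simp_all add: So)
        qed
        hence "symp g (\<omega> h) + symp h (koszul F h g) = 0" by (simp add: symp_koszul)
        ultimately show "ind2 lam (koszul F) \<omega> g h = 0 g h"
          by (simp add: ind2_def 1 bracket_eq_symp vec.scale_left_distrib[symmetric])
      qed
      show "\<omega> (axis k 1) $ None = t k" for k by (simp add: No f_basis)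
    qed
  next
    case 2
    \<comment> \<open>The cubic form \<open>- F(g, g, g)\<close> has the required polarization because \<open>2 = - 1\<close>. The values \<open>t'\<close>
      compensate for it on the basis.\<close>
    define t' where "t' k = t k + tri F (axis k 1) (axis k 1) (axis k 1)" for k
    define \<omega> :: "('a, 'm) heis \<Rightarrow> ('a, 'm) heis" where
      "\<omega> g = (f t' g - tri F g g g) *s axis None 1" for g
    have So: "symp x (\<omega> g) = 0" for x g by (simp add: \<omega>_def)
    have No: "\<omega> g $ None = f t' g - tri F g g g" for g by (simp add: \<omega>_def)
    have 30: "(3 :: 'a) = 0" using of_nat_CHAR[where 'a = 'a] unfolding 2 by simp
    have three: "x + x + x = 0" for x :: 'a
    proof -
      have "x + x + x = 3 * x" by simp
      thus ?thesis by (simp add: 30)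
    qed
    have two: "x + x = - x" for x :: 'a
      using three[of x] by (simp add: eq_neg_iff_add_eq_0)
    have inv2: "inverse 2 = (- 1 :: 'a)"
    proof (rule inverse_unique)
      show "2 * (- 1) = (1 :: 'a)" using three[of 1] by (simp add: algebra_simps eq_neg_iff_add_eq_0)
    qed
    show ?thesis
    proof (intro exI conjI allI)
      show "compatible (koszul F) \<omega>" unfolding compatible_char3[OF 2]
      proof (intro conjI allI)
        fix a g show "\<omega> (a *s g) = a ^ 3 *s \<omega> g"
          by (rule heis_eqI) (simp_all add: So No f_sc 2 tri_linear power3_eq_cube algebra_simps)
      next
        fix g h
        have B: "koszul F (heis_bracket g h) x = 0" for x
          by (simp add: bracket_eq_symp C2D(3)[OF koszul_C2])
        have "tri F (g + h) (g + h) (g + h) = tri F g g g + tri F h h h + tri F g g h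
            + (tri F g h g + tri F g h g) + (tri F g h h + tri F g h h) + tri F h h g"
          by (simp only: tri_linear s[of h g] add_ac)
        hence E: "tri F (g + h) (g + h) (g + h) = tri F g g g + tri F h h h + tri F g g h
            - tri F g h g - tri F g h h + tri F h h g"
          unfolding two by simp
        show "\<omega> (g + h) = \<omega> g + \<omega> h
          + inverse 2 *s (koszul F (heis_bracket g h) g - heis_bracket g (koszul F g h))
          + (koszul F (heis_bracket g h) h - heis_bracket h (koszul F g h))"
          unfolding inv2 B
        proof (rule heis_eqI)
          show "\<omega> (g + h) $ None = (\<omega> g + \<omega> h + - 1 *s (0 - heis_bracket g (koszul F g h))
            + (0 - heis_bracket h (koszul F g h))) $ None"
            by (simp add: No f_add E bracket_eq_symp symp_koszul s[of h g])
        qed (simp add: So bracket_eq_symp)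
      qed
      show "ind2 lam (koszul F) \<omega> = 0" by (rule ind2_koszul_central) (use 2 So in simp_all)
      show "\<omega> (axis k 1) $ None = t k" for k by (simp add: No f_basis t'_def)
    qed
  next
    case 3
    define \<omega> :: "('a, 'm) heis \<Rightarrow> ('a, 'm) heis" where "\<omega> g = f t g *s axis None 1" for g
    show ?thesis
    proof (intro exI conjI allI)
      show "compatible (koszul F) \<omega>"
        unfolding compatible_char_ge5[OF 3 koszul_C2] compatible_0_iff
        by (simp add: semilinear_def \<omega>_def f_add f_sc algebra_simps)
      show "ind2 lam (koszul F) \<omega> = 0"
        by (rule ind2_koszul_central) (use 3 in \<open>simp_all add: \<omega>_def\<close>)
      show "\<omega> (axis k 1) $ None = t k" for k by (simp add: \<omega>_def f_basis)
    qed
  qed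
qed


section \<open>Second cohomology\<close>

text \<open>
  Besides the hook form, the coordinates are those of the central values of \<open>\<omega>\<close> on the basis that
  survive modulo coboundaries. For \<open>p > 2\<close> coboundaries shift these values by multiples of \<open>\<lambda>\<close>; for \<open>\<lambda> \<noteq> 0\<close>
  the minors with the nonzero entry \<open>\<lambda>\<^sub>k\<^sub>0\<close> are coordinates on the quotient. For \<open>p = 2\<close> only the value at \<open>z\<close> is
  left, and it is shifted by multiples of \<open>\<lambda>\<^sub>2\<^sub>m\<^sub>+\<^sub>1\<close>.
\<close>

lemma H2_dim:
  fixes lam :: "('a::field, 'm::finite) heis"
  assumes p: "CHAR('a) > 0" and m: "CARD('m) > 1"
    and k0: "lam \<noteq> 0 \<Longrightarrow> lam $ k0 \<noteq> 0"
    and J: "J = (if CHAR('a) = 2 then (if lam $ None = 0 then {None} else {})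
      else if lam = 0 then UNIV else UNIV - {k0})"
  shows "fin_dim_over (H2_res lam) \<and>
    dim_over (H2_res lam) = card (triples :: (('m + 'm) \<times> ('m + 'm) \<times> ('m + 'm)) set) + card J"
proof -
  let ?e = "\<lambda>i. axis (Some i) 1 :: ('a, 'm) heis"
  define L where "L \<omega> k = (if CHAR('a) = 2 \<or> lam = 0 then \<omega> (axis k 1) $ None
    else lam $ k0 * \<omega> (axis k 1) $ None - lam $ k * \<omega> (axis k0 1) $ None)"
    for \<omega> :: "('a, 'm) heis \<Rightarrow> ('a, 'm) heis" and k
  define f where "f = (\<lambda>(\<phi>, \<omega>). case_sum (\<lambda>(j, i, k). hook_form \<phi> (?e k) (?e i) (?e j)) (L \<omega>))"
  have "fin_dim_over (H2_res lam) \<and> dim_over (H2_res lam) =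
      card ((triples :: (('m + 'm) \<times> ('m + 'm) \<times> ('m + 'm)) set) <+> J)"
    unfolding H2_res_def
  proof (rule quotient_space_dim[where f = f])
    show "vector_space (scale2_res :: 'a \<Rightarrow>
      ((('a, 'm) heis \<Rightarrow> ('a, 'm) heis \<Rightarrow> ('a, 'm) heis) \<times> (('a, 'm) heis \<Rightarrow> ('a, 'm) heis)) \<Rightarrow> _)"
      by (rule vector_space_scale2_res)
    show "module.subspace scale2_res {c \<in> C2_res. d2_res lam c = 0}" by (rule subspace_Z2)
    show "module.subspace scale2_res (d1_res lam ` C1)" by (rule subspace_B2)
    show "d1_res lam ` C1 \<subseteq> {c \<in> C2_res. d2_res lam c = 0}" by (rule d1_res_subset_ker[OF p])
    show "finite (triples <+> J)" by simp
    show "f (x + y) i = f x i + f y i" "f (scale2_res a x) i = a * f x i" for x y i a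
      by (cases x; cases y; auto simp: f_def L_def hook_form_def scale2_res_def algebra_simps split: sum.splits)+
  next
    fix z assume "z \<in> {c \<in> C2_res. d2_res lam c = 0}"
    then obtain \<phi> \<omega> where z: "z = (\<phi>, \<omega>)" and C2: "(\<phi>, \<omega>) \<in> C2_res" and d: "d2_res lam (\<phi>, \<omega>) = 0"
      by (cases z) auto
    show "(\<forall>i\<in>triples <+> J. f z i = 0) \<longleftrightarrow> z \<in> d1_res lam ` C1"
    proof
      assume f0: "\<forall>i\<in>triples <+> J. f z i = 0"
      have "hook_form \<phi> (?e k) (?e i) (?e j) = 0" if "(j, i, k) \<in> triples" for j i k
        using f0[rule_format, of "Inl (j, i, k)"] that by (auto simp: f_def z)
      hence hook_form: "hook_form \<phi> k g h = 0" for k g h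
        using hook_form_eq_0I[OF m, of \<phi> k g h] C2 d by (auto simp: C2_res_def d2_res_def zero_prod_def)
      have L0: "L \<omega> k = 0" if "k \<in> J" for k
        using f0[rule_format, of "Inr k"] that by (auto simp: f_def z)
      \<comment> \<open>The central component of \<open>\<psi>(z)\<close> for the \<open>\<psi>\<close> whose coboundary is sought, read off from \<open>\<omega>\<close> at an
        index where \<open>lam\<close> does not vanish.\<close>
      define \<mu> where "\<mu> = (if CHAR('a) = 2 then if lam $ None = 0 then 0 else - \<omega> (axis None 1) $ None / lam $ None
        else if lam = 0 then 0 else - \<omega> (axis k0 1) $ None / lam $ k0)"
      have "\<omega> (axis k 1) $ None = - \<mu> * lam $ k" if "CHAR('a) = 2 \<Longrightarrow> k = None" for k
      proof (cases "CHAR('a) = 2")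
        case True
        thus ?thesis using L0[of k] that by (auto simp: \<mu>_def J L_def)
      next
        case False
        show ?thesis
        proof (cases "lam = 0")
          case True
          thus ?thesis using False L0[of k] by (simp add: \<mu>_def J L_def)
        next
          case lam: False
          have "lam $ k0 * \<omega> (axis k 1) $ None = lam $ k * \<omega> (axis k0 1) $ None"
            using L0[of k] False lam by (cases "k = k0") (simp_all add: J L_def)
          thus ?thesis using False lam k0[OF lam] by (simp add: \<mu>_def field_simps)
        qed
      qed
      thus "z \<in> d1_res lam ` C1"
        unfolding z by (rule cocycle_is_coboundary[OF p C2 d hook_form, where \<mu> = \<mu>])
    next
      assume "z \<in> d1_res lam ` C1"
      then obtain \<psi> where psi: "\<psi> \<in> C1" and "z = d1_res lam \<psi>" by blast
      hence eq: "\<phi> = d1 \<psi>" "\<omega> = - ind1 lam \<psi>" by (simp_all add: z d1_res_def)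
      have \<omega>: "\<omega> (axis k 1) $ None = - \<psi> (axis None 1) $ None * lam $ k"
        if "CHAR('a) = 2 \<Longrightarrow> k = None" for k
        using that by (simp add: eq ind1_eq[OF p] pmap_basis[OF p] C1D(2)[OF psi])
      have "L \<omega> k = 0" if "k \<in> J" for k
        using that \<omega>[of k] \<omega>[of k0] by (auto simp: L_def J split: if_splits)
      thus "\<forall>i\<in>triples <+> J. f z i = 0"
        by (auto simp: f_def z eq(1) hook_form_d1[OF psi])
    qed
  next
    fix c :: "(('m + 'm) \<times> ('m + 'm) \<times> ('m + 'm)) + ('m + 'm) option \<Rightarrow> 'a"
    obtain F :: "'m + 'm \<Rightarrow> 'm + 'm \<Rightarrow> 'm + 'm \<Rightarrow> 'a" where F: "\<And>x y w. F x y w = F y x w"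
      and Fc: "\<And>j i k. (j, i, k) \<in> triples \<Longrightarrow> F k i j - F k j i = c (Inl (j, i, k))"
      using koszul_prescribed[of "\<lambda>x. c (Inl x)"] by blast
    define t where "t k = (if CHAR('a) = 2 \<or> lam = 0 then c (Inr k)
      else if k = k0 then 0 else c (Inr k) / lam $ k0)" for k
    obtain \<omega> where \<omega>: "compatible (koszul F) \<omega>" "ind2 lam (koszul F) \<omega> = 0"
      "\<And>k. \<omega> (axis k 1) $ None = t k"
      using koszul_restricted[where F = F and lam = lam and t = t, OF p F] by blast
    have "(koszul F, \<omega>) \<in> {c \<in> C2_res. d2_res lam c = 0}"
      using \<omega> koszul_cocycle[of F, OF F]
      by (simp add: C2_res_def koszul_C2 d2_res_def zero_prod_def)
    moreover have "L \<omega> k = c (Inr k)" if "k \<in> J" for k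
      using that k0 by (auto simp: L_def \<omega>(3) t_def J split: if_splits)
    hence "\<forall>i\<in>triples <+> J. f (koszul F, \<omega>) i = c i"
      by (auto simp: f_def hook_form_koszul Fc)
    ultimately show "\<exists>z\<in>{c \<in> C2_res. d2_res lam c = 0}. \<forall>i\<in>triples <+> J. f z i = c i"
      by blast
  qed
  thus ?thesis by (simp add: card_Plus)
qed


section \<open>The dimension formulas\<close>

theorem theorem2p1:
  fixes lam :: "('a::alg_closed_field, 'm::finite) heis" and m p :: nat
  assumes "m = CARD('m)" and "m > 1"
    and "p = CHAR('a)" and "p > 0"
  shows
    "(fin_dim_over (H1_res lam) \<and>
      (p > 2 \<and> lam = 0 \<longrightarrow> real (dim_over (H1_res lam)) = 2 * real m ^ 2 + real m + 1) \<and>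
      (p > 2 \<and> lam \<noteq> 0 \<longrightarrow> real (dim_over (H1_res lam)) = 2 * real m ^ 2 + real m) \<and>
      (p = 2 \<and> lam $ None = 0 \<longrightarrow> real (dim_over (H1_res lam)) = 2 * real m ^ 2 - real m + 1) \<and>
      (p = 2 \<and> lam $ None \<noteq> 0 \<longrightarrow> real (dim_over (H1_res lam)) = 2 * real m ^ 2 - real m)) \<and>
     (fin_dim_over (H2_res lam) \<and>
      (p > 2 \<and> lam = 0 \<longrightarrow>
        real (dim_over (H2_res lam)) = 8 / 3 * real m ^ 3 + 4 / 3 * real m + 1) \<and>
      (p > 2 \<and> lam \<noteq> 0 \<longrightarrow>
        real (dim_over (H2_res lam)) = 8 / 3 * real m ^ 3 + 4 / 3 * real m) \<and>
      (p = 2 \<and> lam $ None = 0 \<longrightarrow>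
        real (dim_over (H2_res lam)) = 8 / 3 * real m ^ 3 - 2 / 3 * real m + 1) \<and>
      (p = 2 \<and> lam $ None \<noteq> 0 \<longrightarrow>
        real (dim_over (H2_res lam)) = 8 / 3 * real m ^ 3 - 2 / 3 * real m))"
proof -
  define n where "n = CARD('m + 'm)"
  have n: "n = 2 * m" by (simp add: n_def assms(1))
  have p: "CHAR('a) > 0" and p2: "p \<noteq> 2 \<longleftrightarrow> p > 2" using assms CHAR_ge2[where 'a = 'a] by auto
  note p_def = \<open>p = CHAR('a)\<close>
  have lt: "real (card (pairs_lt :: (('m + 'm) \<times> ('m + 'm)) set)) = 2 * real m ^ 2 - real m"
  proof -
    have "real (2 * card (pairs_lt :: (('m + 'm) \<times> ('m + 'm)) set) + n) = real (n\<^sup>2)"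
      unfolding n_def card_pairs_lt ..
    thus ?thesis by (simp add: n power2_eq_square)
  qed
  have le: "real (card (pairs_le :: (('m + 'm) \<times> ('m + 'm)) set)) = 2 * real m ^ 2 + real m"
  proof -
    have "real (2 * card (pairs_le :: (('m + 'm) \<times> ('m + 'm)) set)) = real (n\<^sup>2 + n)"
      unfolding n_def card_pairs_le ..
    thus ?thesis by (simp add: n power2_eq_square)
  qed
  have tr: "real (card (triples :: (('m + 'm) \<times> ('m + 'm) \<times> ('m + 'm)) set)) =
      8 / 3 * real m ^ 3 - 2 / 3 * real m"
  proof -
    have "real (3 * card (triples :: (('m + 'm) \<times> ('m + 'm) \<times> ('m + 'm)) set) + n) = real (n ^ 3)"
      unfolding n_def card_triples ..
    thus ?thesis by (simp add: n power_mult_distrib)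
  qed
  have opt: "real (CARD(('m + 'm) option)) = 2 * real m + 1"
    using n by (simp add: n_def card_UNIV_option)
  obtain k0 where k0: "lam \<noteq> 0 \<Longrightarrow> lam $ k0 \<noteq> 0"
    by (metis vec_eq_iff zero_index)
  have opt': "real (card (UNIV - {k0})) = 2 * real m"
    using opt by (simp add: card_Diff_singleton)
  note m_def = assms(1)[symmetric]
  note H1 = H1_dim[OF p refl refl, of lam] and H2 = H2_dim[OF p assms(2)[unfolded assms(1)] k0 refl]
  show ?thesis
  proof (cases "p = 2")
    case True
    thus ?thesis using H1 H2 by (simp add: p_def lt tr)
  next
    case False
    thus ?thesis using H1 H2 p2
      by (cases "lam = 0") (simp_all add: p_def le tr opt opt' m_def)
  qed
qed

end
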